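(* Let $\beta_1,\dots,\beta_L$ satisfy $$\beta_\ell > K_g\prod_{j=\ell+1}^{L}(1+K_{j-1})\quad\text{for all }\ell\in[L],$$ where $K_g>0$ and $K_1,\dots,K_{L-1}>0$ are constants such that, for every $z=(\theta,u)\in \mathrm{lev}_{\le\Theta(z^0)}\Theta$ and all $d,\bar d\in\mathbb{R}^{\bar N}$ with $d_\theta=\bar d_\theta$, $$|g'(u;d_u)-g'(u;\bar d_u)|\le K_g\|d_u-\bar d_u\|,$$ $$\|\psi_{\ell-1}'(\theta,\mathbf{u}_{\ell-1};d_\theta,d_{\mathbf{u}_{\ell-1}})-\psi_{\ell-1}'(\theta,\mathbf{u}_{\ell-1};\bar d_\theta,\bar d_{\mathbf{u}_{\ell-1}})\|\le K_{\ell-1}\|d_{\mathbf{u}_{\ell-1}}-\bar d_{\mathbf{u}_{\ell-1}}\|,\quad \ell=2,\dots,L.$$ Let the initial point $z^1$ satisfy $\Theta(z^1)\le\Theta(z^0)$ and assume that $g$ is convex. (a) If the SRPA algorithm terminates at the $k$th iteration, then $z^k$ is a second-order d-stationary point of $\min_z\Theta(z)$. (b) If the SRPA algorithm does not terminate in a finite number of steps, then any accumulation point of the infinite sequence $\{z^k\}$ is a second-order d-stationary point of $\min_z\Theta(z)$.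
   Context: Setting. Let $L,n,N_1,\dots,N_L$ be positive integers, $[L]=\{1,\dots,L\}$, $\bar N_0=0$, $\bar N_\ell=\sum_{j=1}^{\ell}N_j$, $\bar N=n+\bar N_L$. Write $z=(\theta^\top,u_1^\top,\dots,u_L^\top)^\top\in\mathbb{R}^{\bar N}$, $\theta\in\mathbb{R}^n$, $u_\ell\in\mathbb{R}^{N_\ell}$; $\mathbf{u}_\ell=(u_1^\top,\dots,u_\ell^\top)^\top$, $u=\mathbf u_L$, $\mathbf u_0$ empty. A direction $d\in\mathbb{R}^{\bar N}$ is split in the same way into $d_\theta,d_{u_1},\dots,d_{u_L}$, with $d_{\mathbf u_\ell}$ and $d_u$ defined analogously. Let $g:\mathbb{R}^{\bar N_L}\to\mathbb{R}_+$ and $\psi_{\ell-1}:\mathbb{R}^{n+\bar N_{\ell-1}}\to\mathbb{R}^{N_\ell}$ be locally Lipschitz and twice directionally differentiable (i.e. the limits $f'(x;d)=\lim_{\tau\downarrow0}\frac{f(x+\tau d)-f(x)}{\tau}$ and $f^{(2)}(x;d)=\lim_{\tau\downarrow0}\frac{f(x+\tau d)-f(x)-\tau f'(x;d)}{\tau^2/2}$, componentwise for vector-valued functions, exist for all $x,d$), $\lambda>0$, $\beta_\ell>0$, and $$F(z)=g(u)+\lambda\|\theta\|^2,\quad \Theta(z)=F(z)+\sum_{\ell=1}^L\beta_\ell\|u_\ell-\psi_{\ell-1}(\theta,u_1,\dots,u_{\ell-1})\|_1 .$$ Then $\Theta$ is twice directionally differentiable. The point $z^0=(\mathbf 0,(u_1^0)^\top,\dots,(u_L^0)^\top)^\top$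 is defined recursively by $u_\ell^0=\psi_{\ell-1}(\mathbf 0,u_1^0,\dots,u_{\ell-1}^0)$, $\ell\in[L]$. "Smooth" means differentiable with locally Lipschitz gradient. A function is piecewise affine if its domain is a finite union of polyhedral sets on each of which it is affine. Assume moreover that $g$ is smooth and every component of every $\psi_{\ell-1}$ is either smooth or piecewise affine. Then $\Theta$ is written as $\Theta(z)=F(z)+H(z)+\sum_{j\in\mathcal J}|c_j(z)|$ with $H:\mathbb{R}^{\bar N}\to\mathbb{R}_+$ continuous piecewise affine, $c_j:\mathbb{R}^{\bar N}\to\mathbb{R}$ smooth, $\mathcal J=\{1,\dots,J\}$, $0\le J\le\bar N_L$ (components with piecewise affine $\psi$ are collected in $H$, the others in the $c_j$); fix this decomposition. Fix finitely many nonempty, mutually distinct polyhedra $P_1,\dots,P_I$ with $\bigcup_{i\in[I]}P_i=\mathbb{R}^{\bar N}$ such that $H$ is affine on each $P_i$. Notation: $\|\cdot\|$ Euclidean norm; empty products equal $1$; $\mathbf d(z,P)=\inf_{y\in P}\|z-y\|$; $\mathrm{lev}_{\le\gamma}\Theta=\{z:\Theta(z)\le\gamma\}$; $\mathcal A^\delta(z)=\{i\in[I]:\mathbf d(z,P_i)\le\delta\}$. SRPA algorithm. Input: $z^1\in\mathbb{R}^{\bar N}$, $\rho_1>0$, $\eta_1\in(0,1)$, $\eta_2>1$, $\delta>0$. For $k=1,2,\dots$: with $$\Phi_k(s)=F(z^k)+\nabla F(z^k)^\top s+H(z^k+s)+\sum_{j\in\mathcal J}|c_j(z^k)+\nabla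 c_j(z^k)^\top s|+\frac{\rho_k}{2}\|s\|^2,$$ for each $i\in\mathcal A^\delta(z^k)$ let $s^{k,i}$ be the minimizer of $\Phi_k$ over $\{z-z^k:z\in P_i\}$; let $s^k$ be one of the $s^{k,i}$, $i\in\mathcal A^\delta(z^k)$, with the smallest value of $\Phi_k$. If $\Phi_k(s^k)=\Phi_k(\mathbf 0)$, terminate and output $z^k$. Otherwise, set $(z^{k+1},\rho_{k+1})=(z^k+s^k,\rho_k)$ if $\Theta(z^k)-\Theta(z^k+s^k)\ge\frac{\eta_1\rho_k}{2}\|s^k\|^2$, and $(z^{k+1},\rho_{k+1})=(z^k,\eta_2\rho_k)$ otherwise. Definition: $z$ is a second-order d-stationary point if $\Theta'(z;d)\ge0$ for all $d$, and $\Theta^{(2)}(z;d)\ge0$ for all $d$ with $\Theta'(z;d)=0$. *)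

theory Defs
  imports "HOL-Analysis.Analysis"
begin

section \<open>Directional derivatives and classes of functions\<close>

definition has_dir_deriv ::
  "('a::real_normed_vector \<Rightarrow> 'b::real_normed_vector) \<Rightarrow> 'a \<Rightarrow> 'a \<Rightarrow> 'b \<Rightarrow> bool" where
  "has_dir_deriv f x d D \<longleftrightarrow>
     ((\<lambda>t. (f (x + t *\<^sub>R d) - f x) /\<^sub>R t) \<longlongrightarrow> D) (at_right 0)"

definition dir_deriv ::
  "('a::real_normed_vector \<Rightarrow> 'b::real_normed_vector) \<Rightarrow> 'a \<Rightarrow> 'a \<Rightarrow> 'b" where
  "dir_deriv f x d = (THE D. has_dir_deriv f x d D)"

definition has_dir_deriv2 ::
  "('a::real_normed_vector \<Rightarrow> 'b::real_normed_vector) \<Rightarrow> 'a \<Rightarrow> 'a \<Rightarrow> 'b \<Rightarrow> bool" where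
  "has_dir_deriv2 f x d D \<longleftrightarrow>
     ((\<lambda>t. (f (x + t *\<^sub>R d) - f x - t *\<^sub>R dir_deriv f x d) /\<^sub>R (t\<^sup>2 / 2)) \<longlongrightarrow> D) (at_right 0)"

definition dir_deriv2 ::
  "('a::real_normed_vector \<Rightarrow> 'b::real_normed_vector) \<Rightarrow> 'a \<Rightarrow> 'a \<Rightarrow> 'b" where
  "dir_deriv2 f x d = (THE D. has_dir_deriv2 f x d D)"

definition twice_dir_differentiable ::
  "('a::real_normed_vector \<Rightarrow> 'b::real_normed_vector) \<Rightarrow> bool" where
  "twice_dir_differentiable f \<longleftrightarrow>
     (\<forall>x d. (\<exists>D. has_dir_deriv f x d D) \<and> (\<exists>D. has_dir_deriv2 f x d D))"

definition locally_lipschitz :: "('a::metric_space \<Rightarrow> 'b::metric_space) \<Rightarrow> bool" where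
  "locally_lipschitz f \<longleftrightarrow> (\<forall>x. \<exists>r>0. \<exists>C. C-lipschitz_on (cball x r) f)"

definition grad :: "('a::real_inner \<Rightarrow> real) \<Rightarrow> 'a \<Rightarrow> 'a" where
  "grad f x = (THE D. GDERIV f x :> D)"

definition smooth :: "('a::real_inner \<Rightarrow> real) \<Rightarrow> bool" where
  "smooth f \<longleftrightarrow> (\<forall>x. GDERIV f x :> grad f x) \<and> locally_lipschitz (grad f)"

definition affine_fun_on :: "('a::real_inner \<Rightarrow> real) \<Rightarrow> 'a set \<Rightarrow> bool" where
  "affine_fun_on f S \<longleftrightarrow> (\<exists>a b. \<forall>x\<in>S. f x = a \<bullet> x + b)"

definition piecewise_affine :: "('a::euclidean_space \<Rightarrow> real) \<Rightarrow> bool" where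
  "piecewise_affine f \<longleftrightarrow>
     (\<exists>Q. finite Q \<and> \<Union>Q = UNIV \<and> (\<forall>P\<in>Q. polyhedron P \<and> affine_fun_on f P))"

text \<open>For the function \<open>\<Theta>\<close> below both limits exist in every direction.\<close>

definition second_order_d_stationary ::
  "('a::real_normed_vector \<Rightarrow> real) \<Rightarrow> 'a \<Rightarrow> bool" where
  "second_order_d_stationary f z \<longleftrightarrow>
     (\<forall>d. 0 \<le> dir_deriv f z d) \<and>
     (\<forall>d. dir_deriv f z d = 0 \<longrightarrow> 0 \<le> dir_deriv2 f z d)"

definition accumulation_point :: "'a::topological_space \<Rightarrow> (nat \<Rightarrow> 'a) \<Rightarrow> bool" where
  "accumulation_point x X \<longleftrightarrow> (\<exists>r::nat \<Rightarrow> nat. strict_mono r \<and> (X \<circ> r) \<longlonglongrightarrow> x)"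


section \<open>The penalized problem\<close>

text \<open>
  A point \<open>z = (\<theta>, u)\<close> has type \<open>(real^'n) \<times> (real^'m)\<close>. The index type \<open>'m\<close> collects
  the coordinates of all blocks \<open>u\<^sub>1, \<dots>, u\<^sub>L\<close>, and \<open>layer i\<close> is the number of the block that
  contains coordinate \<open>i\<close>. With \<open>layer ` UNIV = {1..L}\<close>, the block sizes are
  \<open>N\<^sub>l = card {i. layer i = l} > 0\<close>, and every choice of \<open>n\<close>, \<open>L\<close>, \<open>N\<^sub>1, \<dots>, N\<^sub>L\<close> arises in this way.
  A single block and an initial segment of blocks are embedded in \<open>real^'m\<close> by filling up
  with zeros, which preserves the norms.
\<close>

definition block :: "('m::finite \<Rightarrow> nat) \<Rightarrow> nat \<Rightarrow> real^'m \<Rightarrow> real^'m" where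
  "block layer l u = (\<chi> i. if layer i = l then u $ i else 0)"

definition blocks_upto :: "('m::finite \<Rightarrow> nat) \<Rightarrow> nat \<Rightarrow> real^'m \<Rightarrow> real^'m" where
  "blocks_upto layer l u = (\<chi> i. if layer i \<le> l then u $ i else 0)"

text \<open>
  \<open>h\<close> represents a map from vectors \<open>(\<theta>, u\<^sub>1, \<dots>, u\<^sub>l\<^sub>-\<^sub>1)\<close> to vectors indexed by block \<open>l\<close>,
  extended to be independent of the blocks \<open>u\<^sub>l, \<dots>, u\<^sub>L\<close>.
\<close>

definition layer_map ::
  "('m::finite \<Rightarrow> nat) \<Rightarrow> nat \<Rightarrow> ((real^'n::finite) \<times> (real^'m) \<Rightarrow> real^'m) \<Rightarrow> bool" where
  "layer_map layer l h \<longleftrightarrow>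
     (\<forall>\<theta> u. h (\<theta>, u) = block layer l (h (\<theta>, blocks_upto layer (l - 1) u)))"

definition norm1 :: "real^'m::finite \<Rightarrow> real" where
  "norm1 v = (\<Sum>i\<in>UNIV. \<bar>v $ i\<bar>)"

definition F_fun ::
  "(real^'m::finite \<Rightarrow> real) \<Rightarrow> real \<Rightarrow> (real^'n::finite) \<times> (real^'m) \<Rightarrow> real" where
  "F_fun g lam z = g (snd z) + lam * (norm (fst z))\<^sup>2"

text \<open>\<open>\<psi> (l - 1)\<close> is the map that determines block \<open>l\<close>.\<close>

definition Theta ::
  "nat \<Rightarrow> ('m::finite \<Rightarrow> nat) \<Rightarrow> (real^'m \<Rightarrow> real) \<Rightarrow> real \<Rightarrow> (nat \<Rightarrow> real) \<Rightarrow>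
   (nat \<Rightarrow> (real^'n::finite) \<times> (real^'m) \<Rightarrow> real^'m) \<Rightarrow> (real^'n) \<times> (real^'m) \<Rightarrow> real" where
  "Theta L layer g lam \<beta> \<psi> z =
     F_fun g lam z +
     (\<Sum>l=1..L. \<beta> l *
        norm1 (block layer l (snd z) - \<psi> (l - 1) (fst z, blocks_upto layer (l - 1) (snd z))))"

text \<open>
  The decomposition \<open>\<Theta> = F + H + (\<Sum>j\<in>J. \<bar>c\<^sub>j\<bar>)\<close>: the penalty terms of the coordinates in \<open>A\<close>
  (those treated as piecewise affine) are collected in \<open>H\<close>; each remaining coordinate
  \<open>j \<in> - A\<close> contributes one function \<open>c\<^sub>j\<close>. So the complement of \<open>A\<close> plays the role of \<open>J\<close>.
\<close>

definition c_fun ::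
  "('m::finite \<Rightarrow> nat) \<Rightarrow> (nat \<Rightarrow> real) \<Rightarrow>
   (nat \<Rightarrow> (real^'n::finite) \<times> (real^'m) \<Rightarrow> real^'m) \<Rightarrow> 'm \<Rightarrow> (real^'n) \<times> (real^'m) \<Rightarrow> real" where
  "c_fun layer \<beta> \<psi> i z =
     \<beta> (layer i) *
       (snd z $ i - \<psi> (layer i - 1) (fst z, blocks_upto layer (layer i - 1) (snd z)) $ i)"

definition H_fun ::
  "('m::finite \<Rightarrow> nat) \<Rightarrow> (nat \<Rightarrow> real) \<Rightarrow>
   (nat \<Rightarrow> (real^'n::finite) \<times> (real^'m) \<Rightarrow> real^'m) \<Rightarrow> 'm set \<Rightarrow> (real^'n) \<times> (real^'m) \<Rightarrow> real" where
  "H_fun layer \<beta> \<psi> A z = (\<Sum>i\<in>A. \<bar>c_fun layer \<beta> \<psi> i z\<bar>)"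

lemma Theta_decomposition:
  fixes \<psi> :: "nat \<Rightarrow> (real^'n::finite) \<times> (real^'m::finite) \<Rightarrow> real^'m"
  assumes layer: "layer ` UNIV = {1..L}"
    and map: "\<And>l. l \<in> {1..L} \<Longrightarrow> layer_map layer l (\<psi> (l - 1))"
    and pos: "\<And>l. l \<in> {1..L} \<Longrightarrow> 0 < \<beta> l"
  shows "Theta L layer g lam \<beta> \<psi> z =
    F_fun g lam z + H_fun layer \<beta> \<psi> A z + (\<Sum>j\<in>- A. \<bar>c_fun layer \<beta> \<psi> j z\<bar>)"
proof -
  have zero: "\<psi> (l - 1) (\<theta>, u) $ i = 0" if "l \<in> {1..L}" "layer i \<noteq> l" for l \<theta> u i
  proof -
    have "\<psi> (l - 1) (\<theta>, u) $ i = block layer l (\<psi> (l - 1) (\<theta>, blocks_upto layer (l - 1) u)) $ i"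
      using map[OF that(1)] unfolding layer_map_def by (metis (no_types))
    also have "\<dots> = 0"
      using that(2) by (simp add: block_def)
    finally show ?thesis .
  qed
  have layer_in: "layer i \<in> {1..L}" for i
    using layer by blast
  have "\<beta> l * norm1 (block layer l (snd z) - \<psi> (l - 1) (fst z, blocks_upto layer (l - 1) (snd z)))
      = (\<Sum>i\<in>UNIV. if layer i = l then \<bar>c_fun layer \<beta> \<psi> i z\<bar> else 0)" if l: "l \<in> {1..L}" for l
    unfolding norm1_def sum_distrib_left
  proof (rule sum.cong)
    fix i :: 'm
    show "\<beta> l * \<bar>(block layer l (snd z) - \<psi> (l - 1) (fst z, blocks_upto layer (l - 1) (snd z))) $ i\<bar>
        = (if layer i = l then \<bar>c_fun layer \<beta> \<psi> i z\<bar> else 0)"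
    proof (cases "layer i = l")
      case True
      then show ?thesis
        using pos[OF l] by (simp add: block_def c_fun_def abs_mult)
    next
      case False
      then show ?thesis
        using zero[OF l False] by (simp add: block_def)
    qed
  qed simp
  then have "(\<Sum>l=1..L. \<beta> l *
        norm1 (block layer l (snd z) - \<psi> (l - 1) (fst z, blocks_upto layer (l - 1) (snd z))))
      = (\<Sum>l=1..L. \<Sum>i\<in>UNIV. if layer i = l then \<bar>c_fun layer \<beta> \<psi> i z\<bar> else 0)"
    by (rule sum.cong[OF refl])
  also have "\<dots> = (\<Sum>i\<in>UNIV. \<Sum>l=1..L. if layer i = l then \<bar>c_fun layer \<beta> \<psi> i z\<bar> else 0)"
    by (rule sum.swap)
  also have "\<dots> = (\<Sum>i\<in>UNIV. \<bar>c_fun layer \<beta> \<psi> i z\<bar>)"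
    by (rule sum.cong[OF refl]) (subst sum.delta', use layer_in in auto)
  also have "\<dots> = (\<Sum>i\<in>A. \<bar>c_fun layer \<beta> \<psi> i z\<bar>) + (\<Sum>i\<in>- A. \<bar>c_fun layer \<beta> \<psi> i z\<bar>)"
    by (metis Compl_eq_Diff_UNIV add.commute finite subset_UNIV sum.subset_diff)
  finally show ?thesis
    unfolding Theta_def H_fun_def by simp
qed


section \<open>The SRPA algorithm\<close>

definition srpa_model ::
  "('a::euclidean_space \<Rightarrow> real) \<Rightarrow> ('a \<Rightarrow> real) \<Rightarrow> 'j set \<Rightarrow> ('j \<Rightarrow> 'a \<Rightarrow> real) \<Rightarrow>
   'a \<Rightarrow> real \<Rightarrow> 'a \<Rightarrow> real" where
  "srpa_model F H J c zk \<rho> s =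
     F zk + grad F zk \<bullet> s + H (zk + s) + (\<Sum>j\<in>J. \<bar>c j zk + grad (c j) zk \<bullet> s\<bar>)
     + \<rho> / 2 * (norm s)\<^sup>2"

definition near_pieces :: "nat \<Rightarrow> (nat \<Rightarrow> 'a::metric_space set) \<Rightarrow> real \<Rightarrow> 'a \<Rightarrow> nat set" where
  "near_pieces I P \<delta> z = {i \<in> {1..I}. infdist z (P i) \<le> \<delta>}"

text \<open>
  \<open>s\<close> is an admissible trial step at the iterate \<open>zk\<close>; \<open>\<Phi>\<close> is the model, \<open>Act\<close> the set
  of indices of pieces near \<open>zk\<close>, and \<open>t i\<close> the minimizer over the piece \<open>i\<close>.
\<close>

definition srpa_trial_step ::
  "('a::euclidean_space \<Rightarrow> real) \<Rightarrow> nat set \<Rightarrow> (nat \<Rightarrow> 'a set) \<Rightarrow> 'a \<Rightarrow> 'a \<Rightarrow> bool" where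
  "srpa_trial_step \<Phi> Act P zk s \<longleftrightarrow>
     (\<exists>t. (\<forall>i\<in>Act. is_arg_min \<Phi> (\<lambda>y. y \<in> {z - zk |z. z \<in> P i}) (t i)) \<and>
          (\<exists>i\<in>Act. s = t i \<and> (\<forall>i'\<in>Act. \<Phi> s \<le> \<Phi> (t i'))))"

text \<open>The iterates are \<open>Z 1, Z 2, \<dots>\<close>; the values at index \<open>0\<close> are irrelevant.\<close>

definition srpa_terminates_in ::
  "('a::euclidean_space \<Rightarrow> real) \<Rightarrow> ('a \<Rightarrow> real) \<Rightarrow> 'j set \<Rightarrow> ('j \<Rightarrow> 'a \<Rightarrow> real) \<Rightarrow>
   nat \<Rightarrow> (nat \<Rightarrow> 'a set) \<Rightarrow> real \<Rightarrow> (nat \<Rightarrow> 'a) \<Rightarrow> (nat \<Rightarrow> real) \<Rightarrow> (nat \<Rightarrow> 'a) \<Rightarrow> nat \<Rightarrow> bool" where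
  "srpa_terminates_in F H J c I P \<delta> Z \<rho> s k \<longleftrightarrow>
     (let \<Phi> = srpa_model F H J c (Z k) (\<rho> k) in
        srpa_trial_step \<Phi> (near_pieces I P \<delta> (Z k)) P (Z k) (s k) \<and> \<Phi> (s k) = \<Phi> 0)"

definition srpa_continues_in ::
  "('a::euclidean_space \<Rightarrow> real) \<Rightarrow> ('a \<Rightarrow> real) \<Rightarrow> 'j set \<Rightarrow> ('j \<Rightarrow> 'a \<Rightarrow> real) \<Rightarrow>
   nat \<Rightarrow> (nat \<Rightarrow> 'a set) \<Rightarrow> real \<Rightarrow> ('a \<Rightarrow> real) \<Rightarrow> real \<Rightarrow> real \<Rightarrow>
   (nat \<Rightarrow> 'a) \<Rightarrow> (nat \<Rightarrow> real) \<Rightarrow> (nat \<Rightarrow> 'a) \<Rightarrow> nat \<Rightarrow> bool" where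
  "srpa_continues_in F H J c I P \<delta> \<Theta> \<eta>1 \<eta>2 Z \<rho> s k \<longleftrightarrow>
     (let \<Phi> = srpa_model F H J c (Z k) (\<rho> k) in
        srpa_trial_step \<Phi> (near_pieces I P \<delta> (Z k)) P (Z k) (s k) \<and> \<Phi> (s k) \<noteq> \<Phi> 0 \<and>
        (Z (Suc k), \<rho> (Suc k)) =
          (if \<Theta> (Z k) - \<Theta> (Z k + s k) \<ge> \<eta>1 * \<rho> k / 2 * (norm (s k))\<^sup>2
           then (Z k + s k, \<rho> k) else (Z k, \<eta>2 * \<rho> k)))"

definition srpa_terminating_run ::
  "('a::euclidean_space \<Rightarrow> real) \<Rightarrow> ('a \<Rightarrow> real) \<Rightarrow> 'j set \<Rightarrow> ('j \<Rightarrow> 'a \<Rightarrow> real) \<Rightarrow>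
   nat \<Rightarrow> (nat \<Rightarrow> 'a set) \<Rightarrow> real \<Rightarrow> ('a \<Rightarrow> real) \<Rightarrow> real \<Rightarrow> real \<Rightarrow> 'a \<Rightarrow> real \<Rightarrow>
   (nat \<Rightarrow> 'a) \<Rightarrow> (nat \<Rightarrow> real) \<Rightarrow> (nat \<Rightarrow> 'a) \<Rightarrow> nat \<Rightarrow> bool" where
  "srpa_terminating_run F H J c I P \<delta> \<Theta> \<eta>1 \<eta>2 z1 \<rho>1 Z \<rho> s k \<longleftrightarrow>
     1 \<le> k \<and> Z 1 = z1 \<and> \<rho> 1 = \<rho>1 \<and>
     (\<forall>j\<in>{1..<k}. srpa_continues_in F H J c I P \<delta> \<Theta> \<eta>1 \<eta>2 Z \<rho> s j) \<and>
     srpa_terminates_in F H J c I P \<delta> Z \<rho> s k"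

definition srpa_infinite_run ::
  "('a::euclidean_space \<Rightarrow> real) \<Rightarrow> ('a \<Rightarrow> real) \<Rightarrow> 'j set \<Rightarrow> ('j \<Rightarrow> 'a \<Rightarrow> real) \<Rightarrow>
   nat \<Rightarrow> (nat \<Rightarrow> 'a set) \<Rightarrow> real \<Rightarrow> ('a \<Rightarrow> real) \<Rightarrow> real \<Rightarrow> real \<Rightarrow> 'a \<Rightarrow> real \<Rightarrow>
   (nat \<Rightarrow> 'a) \<Rightarrow> (nat \<Rightarrow> real) \<Rightarrow> (nat \<Rightarrow> 'a) \<Rightarrow> bool" where
  "srpa_infinite_run F H J c I P \<delta> \<Theta> \<eta>1 \<eta>2 z1 \<rho>1 Z \<rho> s \<longleftrightarrow>
     Z 1 = z1 \<and> \<rho> 1 = \<rho>1 \<and>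
     (\<forall>j\<ge>1. srpa_continues_in F H J c I P \<delta> \<Theta> \<eta>1 \<eta>2 Z \<rho> s j)"

end

theory Submission
  imports Defs
begin

text \<open>
  The model of SRPA is minimal on every piece near the iterate, hence on a full neighbourhood of
  it. At termination the model is therefore locally minimal at the zero step; along an infinite run
  \<open>\<rho>\<close> stays bounded and the steps tend to zero, and the limit of the models has the same property
  at an accumulation point. As the model agrees with \<open>\<Theta>\<close> to first order, both points are first-order
  d-stationary.

  First-order stationarity suffices. Correcting a direction layer by layer so that its linearized
  residual takes a prescribed value costs at most \<open>K\<^sub>g \<Prod> (1 + K\<^sub>j)\<close> times the change of that residual in
  the derivative of \<open>g\<close>, which is less than the penalty parameter. Hence a stationary point has zero
  residual, and a direction \<open>d\<close> with \<open>\<Theta>'(z; d) = 0\<close> has zero linearized residual and \<open>F'(z; d) = 0\<close>.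
  Convexity of \<open>F\<close> then gives \<open>\<Theta>(z + td) \<ge> F(z + td) \<ge> F(z) = \<Theta>(z)\<close>.
\<close>

section \<open>Smooth functions and directional derivatives\<close>

lemma smooth_has_derivative:
  assumes "smooth f"
  shows "(f has_derivative (\<lambda>h. h \<bullet> grad f x)) (at x)"
  using assms by (simp add: smooth_def gderiv_def)

text \<open>Regarding \<open>f\<close> as a family that is constant over the one-point time set
  \<open>{0}\<close> reduces the claim to the compactness theorem for
  \<open>local_lipschitz\<close>.\<close>

lemma locally_lipschitz_lipschitz_on_compact:
  assumes "locally_lipschitz f" "compact S"
  obtains C where "C-lipschitz_on S f"
proof -
  have "local_lipschitz {0::real} S (\<lambda>_. f)"
  proof (rule local_lipschitzI)
    fix t :: real and x
    obtain r C where "r > 0" "C-lipschitz_on (cball x r) f"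
      using assms(1) unfolding locally_lipschitz_def by blast
    then show "\<exists>u>0. \<exists>L. \<forall>t\<in>cball t u \<inter> {0}. L-lipschitz_on (cball x u \<inter> S) f"
      by (meson Int_lower1 lipschitz_on_subset)
  qed
  then obtain C where "\<And>t::real. t \<in> {0} \<Longrightarrow> C-lipschitz_on S f"
    by (rule local_lipschitz_compact_implies_lipschitz[OF _ assms(2)]) auto
  then show ?thesis using that by blast
qed

lemma locally_lipschitz_continuous_on:
  assumes "locally_lipschitz f"
  shows "continuous_on S f"
proof (rule continuous_at_imp_continuous_on, rule ballI)
  fix x
  obtain r C where "r > 0" "C-lipschitz_on (cball x r) f"
    using assms unfolding locally_lipschitz_def by blast
  then show "isCont f x"
    using lipschitz_on_continuous_on[of C "cball x r" f] continuous_on_interior[of "cball x r" f x]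
    by (simp add: mem_interior) (meson ball_subset_cball)
qed

lemma smooth_continuous_on: "smooth f \<Longrightarrow> continuous_on S f"
  by (meson continuous_at_imp_continuous_on has_derivative_continuous smooth_has_derivative)

lemma smooth_grad_continuous_on: "smooth f \<Longrightarrow> continuous_on S (grad f)"
  by (simp add: locally_lipschitz_continuous_on smooth_def)

text \<open>The segment between two points of the ball stays in the ball, where the gradient has a
  single Lipschitz constant; the mean value theorem along the segment then bounds the remainder. The
  bound is uniform over the ball because the iterates of SRPA move.\<close>

lemma smooth_taylor_bound:
  fixes f :: "'a::euclidean_space \<Rightarrow> real"
  assumes "smooth f"
  obtains M where "0 \<le> M"
    "\<And>x y. x \<in> cball 0 R \<Longrightarrow> y \<in> cball 0 R \<Longrightarrow> \<bar>f y - f x - grad f x \<bullet> (y - x)\<bar> \<le> M * (norm (y - x))\<^sup>2"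
proof -
  obtain M where M: "M-lipschitz_on (cball 0 R) (grad f)"
    using assms locally_lipschitz_lipschitz_on_compact[of "grad f" "cball 0 R"]
    by (auto simp: smooth_def)
  have M0: "0 \<le> M" using M lipschitz_on_nonneg by blast
  have "\<bar>f y - f x - grad f x \<bullet> (y - x)\<bar> \<le> M * (norm (y - x))\<^sup>2"
    if xy: "x \<in> cball 0 R" "y \<in> cball 0 R" for x y
  proof -
    let ?p = "\<lambda>t::real. x + t *\<^sub>R (y - x)"
    have "\<exists>t\<in>{0..1}. f (?p 1) - f (?p 0) = (\<lambda>h. (h *\<^sub>R (y - x)) \<bullet> grad f (?p t)) (1 - 0)"
    proof (rule mvt_very_simple)
      fix t :: real
      have p: "(?p has_derivative (\<lambda>h. h *\<^sub>R (y - x))) (at t within {0..1})"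
        by (auto intro!: derivative_eq_intros)
      have "(f has_derivative (\<lambda>h. h \<bullet> grad f (?p t))) (at (?p t) within ?p ` {0..1})"
        using smooth_has_derivative[OF assms] has_derivative_at_withinI by blast
      from diff_chain_within[OF p this]
      show "((\<lambda>t. f (?p t)) has_derivative (\<lambda>h. (h *\<^sub>R (y - x)) \<bullet> grad f (?p t))) (at t within {0..1})"
        by (simp only: o_def)
    qed simp
    then obtain t where t: "t \<in> {0..1}" "f y - f x = (y - x) \<bullet> grad f (?p t)"
      by auto
    have "?p t = (1 - t) *\<^sub>R x + t *\<^sub>R y" by (simp add: algebra_simps)
    then have "?p t \<in> cball 0 R"
      using t(1) convexD[OF convex_cball xy, of "1 - t" t] by auto
    then have "norm (grad f (?p t) - grad f x) \<le> M * norm (t *\<^sub>R (y - x))"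
      using lipschitz_onD[OF M, of "?p t" x] xy by (simp add: dist_norm)
    also have "\<dots> \<le> M * norm (y - x)"
      using t(1) M0 by (intro mult_left_mono) (auto intro: mult_left_le_one_le)
    finally have n: "norm (grad f (?p t) - grad f x) \<le> M * norm (y - x)" .
    have "f y - f x - grad f x \<bullet> (y - x) = (grad f (?p t) - grad f x) \<bullet> (y - x)"
      using t(2) by (simp only: inner_diff_left inner_commute[of "grad f _"])
    also have "\<bar>\<dots>\<bar> \<le> norm (grad f (?p t) - grad f x) * norm (y - x)"
      by (rule Cauchy_Schwarz_ineq2)
    also have "\<dots> \<le> M * norm (y - x) * norm (y - x)"
      using n by (intro mult_right_mono) auto
    finally show ?thesis by (simp add: power2_eq_square mult.assoc)
  qed
  then show ?thesis using that M0 by blast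
qed

section \<open>Directional derivatives and gradients\<close>

lemma smooth_has_dir_deriv:
  fixes f :: "'a::real_inner \<Rightarrow> real"
  assumes "smooth f"
  shows "has_dir_deriv f x d (grad f x \<bullet> d)"
proof -
  have "(f has_derivative (\<lambda>h. h \<bullet> grad f x)) (at (x + 0 *\<^sub>R d))"
    using smooth_has_derivative[OF assms, of x] by simp
  moreover have "((\<lambda>t::real. x + t *\<^sub>R d) has_derivative (\<lambda>h. h *\<^sub>R d)) (at 0)"
    by (auto intro!: derivative_eq_intros)
  ultimately have "((\<lambda>t. f (x + t *\<^sub>R d)) has_derivative (\<lambda>h. (h *\<^sub>R d) \<bullet> grad f x)) (at 0)"
    by (rule has_derivative_compose[rotated])
  moreover have "(\<lambda>h. (h *\<^sub>R d) \<bullet> grad f x) = (*) (grad f x \<bullet> d)"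
    by (auto simp: inner_commute)
  ultimately have "DERIV (\<lambda>t. f (x + t *\<^sub>R d)) 0 :> grad f x \<bullet> d"
    by (simp add: has_field_derivative_def)
  then show ?thesis
    unfolding has_dir_deriv_def DERIV_def
    by (auto simp: divide_inverse_commute filterlim_at_split)
qed

lemma has_dir_deriv_unique: "has_dir_deriv f x d D \<Longrightarrow> has_dir_deriv f x d D' \<Longrightarrow> D = D'"
  unfolding has_dir_deriv_def using tendsto_unique trivial_limit_at_right_real by blast

lemma dir_derivI: "has_dir_deriv f x d D \<Longrightarrow> dir_deriv f x d = D"
  unfolding dir_deriv_def using has_dir_deriv_unique by blast

lemma has_dir_deriv2_unique: "has_dir_deriv2 f x d D \<Longrightarrow> has_dir_deriv2 f x d D' \<Longrightarrow> D = D'"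
  unfolding has_dir_deriv2_def using tendsto_unique trivial_limit_at_right_real by blast

lemma dir_deriv2I: "has_dir_deriv2 f x d D \<Longrightarrow> dir_deriv2 f x d = D"
  unfolding dir_deriv2_def using has_dir_deriv2_unique by blast

lemma GDERIV_unique: "GDERIV f x :> D \<Longrightarrow> GDERIV f x :> D' \<Longrightarrow> D = D'"
  unfolding gderiv_def
  by (metis has_derivative_unique inner_commute vector_eq_ldot)

lemma smoothI:
  assumes "\<And>x. GDERIV f x :> G x" "locally_lipschitz G"
  shows "smooth f" "grad f = G"
proof -
  show *: "grad f = G"
    unfolding grad_def using assms(1) GDERIV_unique by blast
  show "smooth f" unfolding smooth_def * using assms by simp
qed

lemma locally_lipschitzI:
  assumes "\<And>x. \<exists>r>0. \<exists>C. C-lipschitz_on (cball x r) f"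
  shows "locally_lipschitz f"
  using assms by (simp add: locally_lipschitz_def)

lemma locally_lipschitz_affine:
  fixes f :: "'a::metric_space \<Rightarrow> 'b::real_normed_vector"
  assumes "locally_lipschitz f"
  shows "locally_lipschitz (\<lambda>x. a + k *\<^sub>R f x)"
proof (rule locally_lipschitzI)
  fix x
  obtain r C where r: "r > 0" "C-lipschitz_on (cball x r) f"
    using assms unfolding locally_lipschitz_def by blast
  have "(\<bar>k\<bar> * C)-lipschitz_on (cball x r) (\<lambda>x. k *\<^sub>R f x)"
    by (rule lipschitz_on_cmult[OF r(2)])
  then have "(\<bar>k\<bar> * C)-lipschitz_on (cball x r) (\<lambda>x. a + k *\<^sub>R f x)"
    by (auto simp: lipschitz_on_def)
  then show "\<exists>r>0. \<exists>C. C-lipschitz_on (cball x r) (\<lambda>x. a + k *\<^sub>R f x)"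
    using r(1) by blast
qed

lemma F_fun_smooth:
  fixes g :: "real^'m::finite \<Rightarrow> real" and lam :: real
    and F :: "(real^'n::finite) \<times> (real^'m) \<Rightarrow> real"
  defines "F \<equiv> F_fun g lam"
  assumes "smooth g"
  shows "smooth F" "grad F = (\<lambda>z. ((2 * lam) *\<^sub>R fst z, grad g (snd z)))"
proof -
  have d: "GDERIV F z :> ((2 * lam) *\<^sub>R fst z, grad g (snd z))" for z
  proof -
    have "((\<lambda>z. g (snd z)) has_derivative (\<lambda>h. snd h \<bullet> grad g (snd z))) (at z)"
      using has_derivative_compose[OF has_derivative_snd[OF has_derivative_ident] smooth_has_derivative[OF assms(2)]] .
    moreover have "((\<lambda>z. lam * (fst z \<bullet> fst z))
        has_derivative (\<lambda>h. lam * (fst z \<bullet> fst h + fst h \<bullet> fst z))) (at z)"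
      by (auto intro!: derivative_eq_intros)
    ultimately have "((\<lambda>z. g (snd z) + lam * (fst z \<bullet> fst z)) has_derivative
        (\<lambda>h. snd h \<bullet> grad g (snd z) + lam * (fst z \<bullet> fst h + fst h \<bullet> fst z))) (at z)"
      by (rule has_derivative_add)
    moreover have "F = (\<lambda>z. g (snd z) + lam * (fst z \<bullet> fst z))"
      by (simp add: fun_eq_iff F_def F_fun_def power2_norm_eq_inner)
    ultimately have "(F has_derivative
        (\<lambda>h. snd h \<bullet> grad g (snd z) + lam * (fst z \<bullet> fst h + fst h \<bullet> fst z))) (at z)"
      by simp
    then show ?thesis
      unfolding gderiv_def
      by (rule has_derivative_eq_rhs) (auto simp: inner_prod_def inner_commute)
  qed
  have l: "locally_lipschitz (\<lambda>z::(real^'n) \<times> (real^'m). ((2 * lam) *\<^sub>R fst z, grad g (snd z)))"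
  proof (rule locally_lipschitzI)
    fix z :: "(real^'n) \<times> (real^'m)"
    obtain r C where r: "r > 0" and C: "C-lipschitz_on (cball (snd z) r) (grad g)"
      using assms unfolding smooth_def locally_lipschitz_def by blast
    have f: "1-lipschitz_on (cball z r) fst" and s: "1-lipschitz_on (cball z r) snd"
      by (rule lipschitz_onI; simp add: dist_fst_le dist_snd_le)+
    \<comment> \<open>A ball on which \<open>grad g\<close> is Lipschitz pulls back to a ball of the
      same radius, since \<open>snd\<close> is nonexpansive.\<close>
    have "snd ` cball z r \<subseteq> cball (snd z) r"
    proof (rule image_subsetI)
      fix x assume "x \<in> cball z r"
      then show "snd x \<in> cball (snd z) r" using dist_snd_le[of z x] by simp
    qed
    then have "(C * 1)-lipschitz_on (cball z r) (\<lambda>z. grad g (snd z))"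
      by (intro lipschitz_on_compose2 s lipschitz_on_subset[OF C])
    from lipschitz_on_Pair[OF lipschitz_on_cmult[OF f, of "2 * lam"] this]
    show "\<exists>r>0. \<exists>C. C-lipschitz_on (cball z r) (\<lambda>z. ((2 * lam) *\<^sub>R fst z, grad g (snd z)))"
      using r by blast
  qed
  show "smooth F" "grad F = (\<lambda>z. ((2 * lam) *\<^sub>R fst z, grad g (snd z)))"
    using smoothI[OF d l] by auto
qed

text \<open>The one-sided derivative of the absolute value at \<open>r\<close> in direction
  \<open>D\<close>.\<close>

definition abs_dir :: "real \<Rightarrow> real \<Rightarrow> real" where
  "abs_dir r D = (if r = 0 then \<bar>D\<bar> else sgn r * D)"

lemma has_dir_deriv_imp_tendsto:
  assumes "has_dir_deriv f x d D"
  shows "((\<lambda>t. f (x + t *\<^sub>R d)) \<longlongrightarrow> f x) (at_right 0)"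
proof -
  have "((\<lambda>t. f x + t *\<^sub>R ((f (x + t *\<^sub>R d) - f x) /\<^sub>R t)) \<longlongrightarrow> f x + 0 *\<^sub>R D) (at_right 0)"
    by (intro tendsto_intros assms[unfolded has_dir_deriv_def])
  then have "((\<lambda>t. f x + t *\<^sub>R ((f (x + t *\<^sub>R d) - f x) /\<^sub>R t)) \<longlongrightarrow> f x) (at_right 0)" by simp
  then show ?thesis
    by (rule Lim_transform_eventually) (auto simp: eventually_at_filter)
qed

lemma has_dir_deriv_abs:
  fixes f :: "'a::real_normed_vector \<Rightarrow> real"
  assumes "has_dir_deriv f x d D"
  shows "has_dir_deriv (\<lambda>x. \<bar>f x\<bar>) x d (abs_dir (f x) D)"
proof (cases "f x = 0")
  case True
  \<comment> \<open>At a zero of \<open>f\<close> the factor \<open>t > 0\<close> can be pulled out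
    of the absolute value, so the quotient of \<open>\<bar>f\<bar>\<close> is the absolute value of
    the quotient of \<open>f\<close>.\<close>
  have "((\<lambda>t. \<bar>(f (x + t *\<^sub>R d) - f x) /\<^sub>R t\<bar>) \<longlongrightarrow> \<bar>D\<bar>) (at_right 0)"
    by (intro tendsto_intros assms[unfolded has_dir_deriv_def])
  moreover have "\<forall>\<^sub>F t in at_right 0. \<bar>(f (x + t *\<^sub>R d) - f x) /\<^sub>R t\<bar>
      = (\<bar>f (x + t *\<^sub>R d)\<bar> - \<bar>f x\<bar>) /\<^sub>R t"
    using eventually_at_right_less[of 0] by eventually_elim (simp add: True abs_mult)
  ultimately show ?thesis
    using True unfolding has_dir_deriv_def abs_dir_def by (auto intro: Lim_transform_eventually)
next
  case False
  have "((\<lambda>t. sgn (f x) * ((f (x + t *\<^sub>R d) - f x) /\<^sub>R t)) \<longlongrightarrow> sgn (f x) * D) (at_right 0)"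
    by (intro tendsto_intros assms[unfolded has_dir_deriv_def])
  \<comment> \<open>Away from zero, \<open>f\<close> is continuous along the ray and keeps the sign
    of \<open>f x\<close> for small \<open>t\<close>, so the absolute value acts there as
    multiplication by \<open>sgn (f x)\<close>.\<close>
  moreover have "((\<lambda>t. sgn (f x) * f (x + t *\<^sub>R d)) \<longlongrightarrow> sgn (f x) * f x) (at_right 0)"
    by (intro tendsto_intros has_dir_deriv_imp_tendsto[OF assms])
  then have "\<forall>\<^sub>F t in at_right 0. 0 < sgn (f x) * f (x + t *\<^sub>R d)"
    using False by (intro order_tendstoD(1)[of _ "sgn (f x) * f x"]) (auto simp: sgn_if)
  then have "\<forall>\<^sub>F t in at_right 0. sgn (f x) * ((f (x + t *\<^sub>R d) - f x) /\<^sub>R t)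
      = (\<bar>f (x + t *\<^sub>R d)\<bar> - \<bar>f x\<bar>) /\<^sub>R t"
  proof eventually_elim
    case (elim t)
    then have "\<bar>f (x + t *\<^sub>R d)\<bar> = sgn (f x) * f (x + t *\<^sub>R d)" "\<bar>f x\<bar> = sgn (f x) * f x"
      using False by (auto simp: sgn_if split: if_splits)
    then show ?case by (simp add: algebra_simps)
  qed
  ultimately show ?thesis
    using False unfolding has_dir_deriv_def abs_dir_def by (auto intro: Lim_transform_eventually)
qed

lemma has_dir_deriv_add:
  assumes "has_dir_deriv f x d D" "has_dir_deriv h x d E"
  shows "has_dir_deriv (\<lambda>x. f x + h x) x d (D + E)"
  using tendsto_add[OF assms[unfolded has_dir_deriv_def]]
  unfolding has_dir_deriv_def by (simp add: algebra_simps)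

lemma has_dir_deriv_cmult:
  fixes f :: "'a::real_normed_vector \<Rightarrow> real"
  assumes "has_dir_deriv f x d D"
  shows "has_dir_deriv (\<lambda>x. k * f x) x d (k * D)"
  using tendsto_mult_left[OF assms[unfolded has_dir_deriv_def], of k]
  unfolding has_dir_deriv_def by (simp add: algebra_simps)

lemma has_dir_deriv_sum:
  fixes f :: "'i \<Rightarrow> 'a::real_normed_vector \<Rightarrow> real"
  assumes "\<And>i. i \<in> S \<Longrightarrow> has_dir_deriv (f i) x d (D i)"
  shows "has_dir_deriv (\<lambda>x. \<Sum>i\<in>S. f i x) x d (\<Sum>i\<in>S. D i)"
  using tendsto_sum[of S, OF assms[unfolded has_dir_deriv_def]]
  unfolding has_dir_deriv_def by (simp add: sum_subtractf sum_distrib_left right_diff_distrib)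

lemma has_dir_deriv_0: "has_dir_deriv f x 0 0"
  by (simp add: has_dir_deriv_def)

lemma twice_dir_differentiable_dir_deriv:
  assumes "twice_dir_differentiable f"
  shows "has_dir_deriv f x d (dir_deriv f x d)"
  using assms dir_derivI unfolding twice_dir_differentiable_def by metis

text \<open>Convexity bounds the difference quotient for every \<open>t\<close> in (0,1) by its
  value at \<open>t = 1\<close>; then \<open>t\<close> tends to 0.\<close>

lemma convex_on_dir_deriv_le:
  fixes f :: "'a::real_normed_vector \<Rightarrow> real"
  assumes "convex_on UNIV f" "has_dir_deriv f x d D"
  shows "f x + D \<le> f (x + d)"
proof -
  have "\<forall>\<^sub>F t in at_right 0. (f (x + t *\<^sub>R d) - f x) /\<^sub>R t \<le> f (x + d) - f x"
    using eventually_at_right_real[of 0 1, OF zero_less_one]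
  proof eventually_elim
    case (elim t)
    have "x + t *\<^sub>R d = (1 - t) *\<^sub>R x + t *\<^sub>R (x + d)" by (simp add: algebra_simps)
    then have "f (x + t *\<^sub>R d) \<le> (1 - t) * f x + t * f (x + d)"
      using convex_onD[OF assms(1), of t x "x + d"] elim by simp
    then show ?case using elim by (simp add: field_simps)
  qed
  then have "D \<le> f (x + d) - f x"
    using assms(2) unfolding has_dir_deriv_def by (intro tendsto_upperbound[of _ D "at_right 0"]) auto
  then show ?thesis by simp
qed

section \<open>Convergence of SRPA to first-order stationary points\<close>

lemma srpa_model_0: "srpa_model F H J c z \<rho> 0 = F z + H z + (\<Sum>j\<in>J. \<bar>c j z\<bar>)"
  by (simp add: srpa_model_def)

text \<open>The property shared by points where SRPA stops and accumulation points of its iterates.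
  No piece occurs in it: the pieces near a point together cover a neighbourhood of that
  point.\<close>

definition model_local_min where
  "model_local_min F H J c z \<rho> \<longleftrightarrow>
     (\<exists>r>0. \<forall>s. norm s < r \<longrightarrow> srpa_model F H J c z \<rho> 0 \<le> srpa_model F H J c z \<rho> s)"

text \<open>\<open>H\<close> enters the model and \<Theta> in the same form and cancels; linearizing
  \<open>F\<close> and the \<open>c j\<close> costs o(t) along the ray, and the proximal term is of
  order t^2.\<close>

lemma model_local_min_dir_deriv_nonneg:
  fixes \<Theta> :: "'a::euclidean_space \<Rightarrow> real"
  assumes F: "smooth F" and c: "\<And>j. j \<in> J \<Longrightarrow> smooth (c j)"
    and \<Theta>: "\<And>z. \<Theta> z = F z + H z + (\<Sum>j\<in>J. \<bar>c j z\<bar>)"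
    and min: "model_local_min F H J c z \<rho>"
    and D: "has_dir_deriv \<Theta> z d D"
  shows "0 \<le> D"
proof -
  let ?q = "\<lambda>f t. (f (z + t *\<^sub>R d) - f z) /\<^sub>R t"
  \<comment> \<open>A lower bound for the difference quotient of \<Theta>: the linearization error
    of \<open>F\<close>, minus those of the \<open>c j\<close> in absolute value, minus the proximal
    term divided by \<open>t\<close>. It tends to 0.\<close>
  let ?e = "\<lambda>t. (?q F t - grad F z \<bullet> d) - (\<Sum>j\<in>J. \<bar>?q (c j) t - grad (c j) z \<bullet> d\<bar>) - \<rho> / 2 * t * (norm d)\<^sup>2"
  have q: "(?q f \<longlongrightarrow> grad f z \<bullet> d) (at_right 0)" if "smooth f" for f :: "'a \<Rightarrow> real"
    using smooth_has_dir_deriv[OF that] by (simp add: has_dir_deriv_def)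
  have "(?e \<longlongrightarrow> (grad F z \<bullet> d - grad F z \<bullet> d) - (\<Sum>j\<in>J. \<bar>grad (c j) z \<bullet> d - grad (c j) z \<bullet> d\<bar>)
      - \<rho> / 2 * 0 * (norm d)\<^sup>2) (at_right 0)"
    by (intro tendsto_intros q F c)
  then have e: "(?e \<longlongrightarrow> 0) (at_right 0)" by simp
  obtain r where r: "r > 0" "\<And>s. norm s < r \<Longrightarrow> srpa_model F H J c z \<rho> 0 \<le> srpa_model F H J c z \<rho> s"
    using min unfolding model_local_min_def by blast
  have "\<forall>\<^sub>F t in at_right 0. norm (t *\<^sub>R d) < r"
    using r(1) by (intro order_tendstoD(2)[of _ 0]) (auto intro!: tendsto_eq_intros)
  then have "\<forall>\<^sub>F t in at_right 0. ?e t \<le> ?q \<Theta> t"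
    using eventually_at_right_less
  proof eventually_elim
    case (elim t)
    have "srpa_model F H J c z \<rho> 0 \<le> srpa_model F H J c z \<rho> (t *\<^sub>R d)"
      using r(2) elim by blast
    then have a: "(\<Sum>j\<in>J. \<bar>c j z\<bar>) + H z \<le> t * (grad F z \<bullet> d) + H (z + t *\<^sub>R d)
       + (\<Sum>j\<in>J. \<bar>c j z + t * (grad (c j) z \<bullet> d)\<bar>) + \<rho> / 2 * t\<^sup>2 * (norm d)\<^sup>2"
      by (simp add: srpa_model_def power_mult_distrib mult.assoc)
    have "(\<Sum>j\<in>J. \<bar>c j z + t * (grad (c j) z \<bullet> d)\<bar>) \<le>
      (\<Sum>j\<in>J. \<bar>c j (z + t *\<^sub>R d)\<bar> + t * \<bar>?q (c j) t - grad (c j) z \<bullet> d\<bar>)"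
    proof (rule sum_mono)
      fix j
      have "t * \<bar>?q (c j) t - grad (c j) z \<bullet> d\<bar> = \<bar>t * (?q (c j) t - grad (c j) z \<bullet> d)\<bar>"
        using elim by (simp add: abs_mult)
      also have "t * (?q (c j) t - grad (c j) z \<bullet> d)
          = c j (z + t *\<^sub>R d) - c j z - t * (grad (c j) z \<bullet> d)"
        using elim by (simp add: right_diff_distrib mult.assoc[symmetric])
      finally show "\<bar>c j z + t * (grad (c j) z \<bullet> d)\<bar>
          \<le> \<bar>c j (z + t *\<^sub>R d)\<bar> + t * \<bar>?q (c j) t - grad (c j) z \<bullet> d\<bar>"
        by linarith
    qed
    moreover have "t * ?e t = F (z + t *\<^sub>R d) - F z - t * (grad F z \<bullet> d)
        - (\<Sum>j\<in>J. t * \<bar>?q (c j) t - grad (c j) z \<bullet> d\<bar>) - \<rho> / 2 * t\<^sup>2 * (norm d)\<^sup>2"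
      using elim by (simp add: right_diff_distrib sum_distrib_left power2_eq_square mult.assoc[symmetric])
    ultimately have "t * ?e t \<le> \<Theta> (z + t *\<^sub>R d) - \<Theta> z"
      using a by (simp add: \<Theta> sum.distrib)
    then show ?case using elim by (simp add: pos_le_divide_eq divide_inverse_commute[symmetric] mult.commute)
  qed
  then show ?thesis
    using D[unfolded has_dir_deriv_def] e by (intro tendsto_le[of "at_right 0" "?q \<Theta>" D ?e 0]) auto
qed

lemma continuous_on_UNIV_tendsto:
  assumes "continuous_on UNIV f" "(X \<longlongrightarrow> x) G"
  shows "((\<lambda>n. f (X n)) \<longlongrightarrow> f x) G"
  using assms by (intro continuous_on_tendsto_compose[of UNIV f]) auto

text \<open>Runs start at index 1, so limits are proved for the shifted sequence, while an
  accumulation point comes with unshifted indices \<open>q n\<close>. The entry at index 0 does not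
  affect the limit.\<close>

lemma LIMSEQ_subseq_Suc:
  assumes "(\<lambda>n. X (Suc n)) \<longlonglongrightarrow> x" "strict_mono q"
  shows "(\<lambda>n. X (q n)) \<longlonglongrightarrow> x"
  using LIMSEQ_subseq_LIMSEQ[OF LIMSEQ_imp_Suc[OF assms(1)] assms(2)] by (simp add: o_def)

text \<open>Convergence to stationary points is proved for an abstract decomposition of \<Theta>
  with a bounded level set, separately from the layered structure that later provides both.\<close>

locale srpa =
  fixes F H :: "'a::euclidean_space \<Rightarrow> real"
    and J :: "'j set" and c :: "'j \<Rightarrow> 'a \<Rightarrow> real"
    and I :: nat and P :: "nat \<Rightarrow> 'a set" and \<delta> :: real
    and \<Theta> :: "'a \<Rightarrow> real" and \<eta>1 \<eta>2 :: real and z1 :: 'a and \<rho>1 :: real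
  assumes F_smooth: "smooth F"
    and c_smooth: "j \<in> J \<Longrightarrow> smooth (c j)"
    and J_finite: "finite J"
    and H_continuous: "continuous_on UNIV H"
    and F_nonneg: "0 \<le> F z"
    and H_nonneg: "0 \<le> H z"
    and cover: "(\<Union>i\<in>{1..I}. P i) = UNIV"
    and \<delta>_pos: "0 < \<delta>"
    and \<Theta>_eq: "\<Theta> z = F z + H z + (\<Sum>j\<in>J. \<bar>c j z\<bar>)"
    and \<eta>1: "0 < \<eta>1" "\<eta>1 < 1"
    and \<eta>2: "1 < \<eta>2"
    and \<rho>1_pos: "0 < \<rho>1"
    and level_bounded: "bounded {z. \<Theta> z \<le> \<Theta> z1}"
begin

section \<open>The model and a single iteration\<close>

abbreviation "model \<equiv> srpa_model F H J c"

abbreviation "continues_in \<equiv> srpa_continues_in F H J c I P \<delta> \<Theta> \<eta>1 \<eta>2"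

lemma model_0: "model z \<rho> 0 = \<Theta> z"
  by (simp add: srpa_model_0 \<Theta>_eq)

lemma \<Theta>_nonneg: "0 \<le> \<Theta> z"
  using F_nonneg[of z] H_nonneg[of z] by (simp add: \<Theta>_eq sum_nonneg)

lemma \<Theta>_continuous: "continuous_on UNIV \<Theta>"
  unfolding \<Theta>_eq
  by (intro continuous_intros H_continuous smooth_continuous_on F_smooth c_smooth)

text \<open>Joint continuity: in the limit along a run, the iterate, the parameter \<rho> and the
  step vary simultaneously.\<close>

lemma tendsto_model:
  assumes "(X \<longlongrightarrow> x) G" "(R \<longlongrightarrow> r) G" "(S \<longlongrightarrow> s) G"
  shows "((\<lambda>n. model (X n) (R n) (S n)) \<longlongrightarrow> model x r s) G"
  unfolding srpa_model_def
  by (intro tendsto_intros assms continuous_on_UNIV_tendsto[OF H_continuous]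
      continuous_on_UNIV_tendsto[OF smooth_continuous_on[OF F_smooth]]
      continuous_on_UNIV_tendsto[OF smooth_grad_continuous_on[OF F_smooth]]
      continuous_on_UNIV_tendsto[OF smooth_continuous_on[OF c_smooth]]
      continuous_on_UNIV_tendsto[OF smooth_grad_continuous_on[OF c_smooth]]) simp_all

text \<open>A point \<open>y\<close> within \<delta> of \<open>z\<close> lies in some piece, which
  is therefore at distance at most \<delta> and competes for the trial step. So the trial step beats
  every step of length at most \<delta>, whichever piece it leads to.\<close>

lemma trial_step_le:
  assumes s: "srpa_trial_step \<Phi> (near_pieces I P \<delta> z) P z s" and y: "dist z y \<le> \<delta>"
  shows "\<Phi> s \<le> \<Phi> (y - z)"
proof -
  obtain i where i: "i \<in> {1..I}" "y \<in> P i" using cover by blast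
  then have "i \<in> near_pieces I P \<delta> z"
    using infdist_le2[OF i(2) y] by (simp add: near_pieces_def)
  moreover obtain t where t: "\<forall>i\<in>near_pieces I P \<delta> z. is_arg_min \<Phi> (\<lambda>y. y \<in> {w - z |w. w \<in> P i}) (t i)"
      "\<forall>i\<in>near_pieces I P \<delta> z. \<Phi> s \<le> \<Phi> (t i)"
    using s unfolding srpa_trial_step_def by blast
  ultimately have "\<Phi> s \<le> \<Phi> (t i)" "is_arg_min \<Phi> (\<lambda>y. y \<in> {w - z |w. w \<in> P i}) (t i)" by auto
  moreover have "y - z \<in> {w - z |w. w \<in> P i}" using i by blast
  ultimately show ?thesis unfolding is_arg_min_def by (meson not_less order_trans)
qed

lemma trial_step_le_0:
  assumes "srpa_trial_step \<Phi> (near_pieces I P \<delta> z) P z s"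
  shows "\<Phi> s \<le> \<Phi> 0"
  using trial_step_le[OF assms, of z] \<delta>_pos by simp

text \<open>The stopping test says that the zero step attains the value of the trial step, which is
  minimal over the ball of radius \<delta>.\<close>

lemma terminates_in_model_local_min:
  assumes "srpa_terminates_in F H J c I P \<delta> Z \<rho> s k"
  shows "model_local_min F H J c (Z k) (\<rho> k)"
proof -
  have s: "srpa_trial_step (model (Z k) (\<rho> k)) (near_pieces I P \<delta> (Z k)) P (Z k) (s k)"
    "model (Z k) (\<rho> k) (s k) = model (Z k) (\<rho> k) 0"
    using assms by (auto simp: srpa_terminates_in_def Let_def)
  have "model (Z k) (\<rho> k) 0 \<le> model (Z k) (\<rho> k) v" if "norm v < \<delta>" for v
    using trial_step_le[OF s(1), of "Z k + v"] s(2) that by (simp add: dist_norm)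
  then show ?thesis using \<delta>_pos unfolding model_local_min_def by blast
qed

lemma continues_in_cases:
  assumes "continues_in Z \<rho> s k"
  obtains (success) "\<eta>1 * \<rho> k / 2 * (norm (s k))\<^sup>2 \<le> \<Theta> (Z k) - \<Theta> (Z k + s k)"
      "Z (Suc k) = Z k + s k" "\<rho> (Suc k) = \<rho> k"
  | (failure) "\<Theta> (Z k) - \<Theta> (Z k + s k) < \<eta>1 * \<rho> k / 2 * (norm (s k))\<^sup>2"
      "Z (Suc k) = Z k" "\<rho> (Suc k) = \<eta>2 * \<rho> k"
  using assms by (auto simp: srpa_continues_in_def Let_def split: if_splits)

lemma continues_in_trial_step:
  assumes "continues_in Z \<rho> s k"
  shows "srpa_trial_step (model (Z k) (\<rho> k)) (near_pieces I P \<delta> (Z k)) P (Z k) (s k)"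
  using assms by (simp add: srpa_continues_in_def Let_def)

lemma continues_in_mono:
  assumes "continues_in Z \<rho> s k" "0 < \<rho> k"
  shows "\<rho> k \<le> \<rho> (Suc k)" "\<Theta> (Z (Suc k)) \<le> \<Theta> (Z k)"
proof -
  have *: "0 \<le> \<eta>1 * \<rho> k / 2 * (norm (s k))\<^sup>2" using \<eta>1 assms(2) by simp
  from assms(1) have "\<rho> k \<le> \<rho> (Suc k) \<and> \<Theta> (Z (Suc k)) \<le> \<Theta> (Z k)"
    by (cases rule: continues_in_cases) (use * \<eta>2 assms(2) in auto)
  then show "\<rho> k \<le> \<rho> (Suc k)" "\<Theta> (Z (Suc k)) \<le> \<Theta> (Z k)" by auto
qed

lemma run_invariant:
  assumes "Z 1 = z1" "\<rho> 1 = \<rho>1" "1 \<le> k" "\<And>j. j \<in> {1..<k} \<Longrightarrow> continues_in Z \<rho> s j"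
  shows "\<rho>1 \<le> \<rho> k \<and> \<Theta> (Z k) \<le> \<Theta> z1"
  using assms(3,4)
proof (induction k rule: dec_induct)
  case base
  then show ?case using assms by simp
next
  case (step k)
  then have "\<rho>1 \<le> \<rho> k" "\<Theta> (Z k) \<le> \<Theta> z1" "continues_in Z \<rho> s k" by auto
  then show ?case using continues_in_mono[of Z \<rho> s k] \<rho>1_pos by auto
qed

text \<open>If the model does not exceed \<Theta> at the iterate, the quadratic term is at most a
  constant plus a multiple of \<open>norm s\<close>. The lower bound \<open>\<rho>1\<close> makes
  the resulting estimate uniform in \<rho>.\<close>

lemma step_bounded:
  obtains S where "0 \<le> S"
    "\<And>z \<rho> s. \<Theta> z \<le> \<Theta> z1 \<Longrightarrow> \<rho>1 \<le> \<rho> \<Longrightarrow> model z \<rho> s \<le> \<Theta> z \<Longrightarrow> norm s \<le> S"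
proof -
  have "compact {z. \<Theta> z \<le> \<Theta> z1}"
    using level_bounded closed_Collect_le[OF \<Theta>_continuous continuous_on_const]
    by (simp add: compact_eq_bounded_closed)
  then have "bounded (grad F ` {z. \<Theta> z \<le> \<Theta> z1})"
    by (intro compact_imp_bounded compact_continuous_image smooth_grad_continuous_on F_smooth)
  then obtain G where G: "0 < G" "\<And>z. \<Theta> z \<le> \<Theta> z1 \<Longrightarrow> norm (grad F z) \<le> G"
    unfolding bounded_pos by auto
  \<comment> \<open>The summand 1 covers short steps. For \<open>norm s > 1\<close> the constant
    \<open>\<Theta> z1\<close> is at most \<open>\<Theta> z1 * norm s\<close>, and one factor
    \<open>norm s\<close> cancels.\<close>
  define S where "S = 1 + 2 * (G + \<Theta> z1) / \<rho>1"
  have "norm s \<le> S" if "\<Theta> z \<le> \<Theta> z1" "\<rho>1 \<le> \<rho>" "model z \<rho> s \<le> \<Theta> z" for z \<rho> s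
  proof (cases "norm s \<le> 1")
    case True
    then show ?thesis using G \<Theta>_nonneg[of z1] \<rho>1_pos
      by (simp add: S_def add_increasing2)
  next
    case False
    have "- (G * norm s) \<le> grad F z \<bullet> s"
      using Cauchy_Schwarz_ineq2[of "grad F z" s] mult_right_mono[OF G(2)[OF that(1)], of "norm s"] by auto
    moreover have "0 \<le> (\<Sum>j\<in>J. \<bar>c j z + grad (c j) z \<bullet> s\<bar>)" by (simp add: sum_nonneg)
    ultimately have "\<rho> / 2 * (norm s)\<^sup>2 \<le> \<Theta> z1 + G * norm s"
      using that F_nonneg[of z] H_nonneg[of "z + s"] unfolding srpa_model_def by linarith
    moreover have "\<rho>1 / 2 * (norm s)\<^sup>2 \<le> \<rho> / 2 * (norm s)\<^sup>2"
      using that by (intro mult_right_mono) auto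
    moreover have "\<Theta> z1 \<le> \<Theta> z1 * norm s"
      using False \<Theta>_nonneg[of z1] by (simp add: mult_le_cancel_left1)
    ultimately have "(\<rho>1 / 2 * norm s) * norm s \<le> (\<Theta> z1 + G) * norm s"
      by (simp add: power2_eq_square algebra_simps)
    moreover have "0 < norm s" using False by linarith
    ultimately have "\<rho>1 / 2 * norm s \<le> \<Theta> z1 + G" using mult_le_cancel_right_pos by blast
    then show ?thesis using \<rho>1_pos by (simp add: S_def field_simps)
  qed
  moreover have "0 \<le> S" using G \<rho>1_pos \<Theta>_nonneg[of z1] by (simp add: S_def)
  ultimately show ?thesis using that by blast
qed

text \<open>Only \<open>F\<close> and the \<open>c j\<close> are linearized, each with a quadratic
  error. Subtracting the proximal term from the model makes \<open>M\<close> independent of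
  \<rho>.\<close>

lemma model_error_bound:
  obtains M where "0 \<le> M"
    "\<And>z s \<rho>. z \<in> cball 0 R \<Longrightarrow> z + s \<in> cball 0 R \<Longrightarrow>
       \<Theta> (z + s) \<le> model z \<rho> s - \<rho> / 2 * (norm s)\<^sup>2 + M * (norm s)\<^sup>2"
proof -
  obtain M0 where M0: "0 \<le> M0" "\<And>x y. x \<in> cball 0 R \<Longrightarrow> y \<in> cball 0 R
      \<Longrightarrow> \<bar>F y - F x - grad F x \<bullet> (y - x)\<bar> \<le> M0 * (norm (y - x))\<^sup>2"
    by (rule smooth_taylor_bound[OF F_smooth, of R]) blast
  have "\<forall>j\<in>J. \<exists>M\<ge>0. \<forall>x\<in>cball 0 R. \<forall>y\<in>cball 0 R. \<bar>c j y - c j x - grad (c j) x \<bullet> (y - x)\<bar>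
      \<le> M * (norm (y - x))\<^sup>2"
  proof
    fix j assume "j \<in> J"
    show "\<exists>M\<ge>0. \<forall>x\<in>cball 0 R. \<forall>y\<in>cball 0 R. \<bar>c j y - c j x - grad (c j) x \<bullet> (y - x)\<bar>
        \<le> M * (norm (y - x))\<^sup>2"
      by (rule smooth_taylor_bound[OF c_smooth[OF \<open>j \<in> J\<close>], of R]) blast
  qed
  then obtain M where M: "\<And>j. j \<in> J \<Longrightarrow> 0 \<le> M j"
      "\<And>j x y. j \<in> J \<Longrightarrow> x\<in>cball 0 R \<Longrightarrow> y\<in>cball 0 R
          \<Longrightarrow> \<bar>c j y - c j x - grad (c j) x \<bullet> (y - x)\<bar> \<le> M j * (norm (y - x))\<^sup>2"
    unfolding bchoice_iff by blast
  show ?thesis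
  proof (rule that)
    show "0 \<le> M0 + sum M J" using M0 M by (simp add: sum_nonneg)
    fix z s :: 'a and \<rho> :: real assume z: "z \<in> cball 0 R" "z + s \<in> cball 0 R"
    have "(\<Sum>j\<in>J. \<bar>c j (z + s)\<bar>) \<le> (\<Sum>j\<in>J. \<bar>c j z + grad (c j) z \<bullet> s\<bar> + M j * (norm s)\<^sup>2)"
    proof (rule sum_mono)
      fix j assume "j \<in> J"
      from M(2)[OF this z] show "\<bar>c j (z + s)\<bar> \<le> \<bar>c j z + grad (c j) z \<bullet> s\<bar> + M j * (norm s)\<^sup>2"
        by simp
    qed
    then show "\<Theta> (z + s) \<le> model z \<rho> s - \<rho> / 2 * (norm s)\<^sup>2 + (M0 + sum M J) * (norm s)\<^sup>2"
      using M0(2)[OF z] by (simp add: \<Theta>_eq srpa_model_def sum.distrib sum_distrib_right distrib_right)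
  qed
qed

section \<open>Infinite runs\<close>

context
  fixes Z \<rho> s
  assumes run: "srpa_infinite_run F H J c I P \<delta> \<Theta> \<eta>1 \<eta>2 z1 \<rho>1 Z \<rho> s"
begin

lemma run_continues: "1 \<le> k \<Longrightarrow> continues_in Z \<rho> s k"
  using run by (simp add: srpa_infinite_run_def)

lemma infinite_run_invariant:
  assumes "1 \<le> k"
  shows "\<rho>1 \<le> \<rho> k" "\<Theta> (Z k) \<le> \<Theta> z1"
  using run_invariant[of Z \<rho> k s] assms run by (auto simp: srpa_infinite_run_def)

lemma run_\<rho>_pos: "1 \<le> k \<Longrightarrow> 0 < \<rho> k"
  using infinite_run_invariant(1)[of k] \<rho>1_pos by simp

text \<open>The actual decrease is at least the predicted one plus the proximal term minus the model
  error, and for large \<rho> the proximal term dominates that error.\<close>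

lemma success_if_\<rho>_large:
  obtains T where "\<And>k. 1 \<le> k \<Longrightarrow> T \<le> \<rho> k \<Longrightarrow>
    \<eta>1 * \<rho> k / 2 * (norm (s k))\<^sup>2 \<le> \<Theta> (Z k) - \<Theta> (Z k + s k)"
proof -
  obtain S where S: "0 \<le> S"
    "\<And>z \<rho> s. \<Theta> z \<le> \<Theta> z1 \<Longrightarrow> \<rho>1 \<le> \<rho> \<Longrightarrow> model z \<rho> s \<le> \<Theta> z \<Longrightarrow> norm s \<le> S"
    using step_bounded by blast
  \<comment> \<open>\<open>B\<close> bounds the iterates and \<open>S\<close> the steps, so the ball
    of radius \<open>B + S\<close> contains each iterate together with its trial point.\<close>
  obtain B where B: "\<And>z. \<Theta> z \<le> \<Theta> z1 \<Longrightarrow> norm z \<le> B"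
    using level_bounded unfolding bounded_iff by auto
  obtain M where M: "0 \<le> M"
    "\<And>z s \<rho>. z \<in> cball 0 (B + S) \<Longrightarrow> z + s \<in> cball 0 (B + S) \<Longrightarrow>
       \<Theta> (z + s) \<le> model z \<rho> s - \<rho> / 2 * (norm s)\<^sup>2 + M * (norm s)\<^sup>2"
    using model_error_bound by blast
  show ?thesis
  proof (rule that)
    \<comment> \<open>The threshold is the solution of
      \<open>\<rho> / 2 - M = \<eta>1 * \<rho> / 2\<close>.\<close>
    fix k :: nat assume k: "1 \<le> k" and T: "2 * M / (1 - \<eta>1) \<le> \<rho> k"
    note inv = infinite_run_invariant[OF k]
    have le: "model (Z k) (\<rho> k) (s k) \<le> \<Theta> (Z k)"
      using trial_step_le_0[OF continues_in_trial_step[OF run_continues[OF k]]] by (simp add: model_0)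
    have "norm (s k) \<le> S" using S(2)[OF inv(2,1) le] .
    then have "\<Theta> (Z k + s k) \<le> model (Z k) (\<rho> k) (s k) - \<rho> k / 2 * (norm (s k))\<^sup>2 + M * (norm (s k))\<^sup>2"
      using B[OF inv(2)] S(1) norm_triangle_ineq[of "Z k" "s k"] by (intro M) auto
    moreover have "(\<eta>1 * \<rho> k / 2) * (norm (s k))\<^sup>2 \<le> (\<rho> k / 2 - M) * (norm (s k))\<^sup>2"
      using T \<eta>1 by (intro mult_right_mono) (auto simp: field_simps)
    ultimately show "\<eta>1 * \<rho> k / 2 * (norm (s k))\<^sup>2 \<le> \<Theta> (Z k) - \<Theta> (Z k + s k)"
      using le by (simp add: left_diff_distrib)
  qed
qed

lemma \<rho>_convergent: "convergent (\<lambda>n. \<rho> (Suc n))"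
proof -
  text \<open>Once \<open>\<rho>\<close> has reached \<open>T\<close>, no step fails, so \<open>\<rho>\<close> never exceeds \<open>max \<rho>1 (\<eta>2 * T)\<close>.\<close>
  obtain T where T: "\<And>k. 1 \<le> k \<Longrightarrow> T \<le> \<rho> k \<Longrightarrow>
    \<eta>1 * \<rho> k / 2 * (norm (s k))\<^sup>2 \<le> \<Theta> (Z k) - \<Theta> (Z k + s k)"
    using success_if_\<rho>_large by blast
  have "\<rho> (Suc n) \<le> max \<rho>1 (\<eta>2 * T)" for n
  proof (induction n)
    case 0
    then show ?case using run by (simp add: srpa_infinite_run_def)
  next
    case (Suc n)
    have "continues_in Z \<rho> s (Suc n)" by (rule run_continues) simp
    then show ?case
    proof (cases rule: continues_in_cases)
      case success
      then show ?thesis using Suc by simp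
    next
      case failure
      then have "\<rho> (Suc n) < T" using T[of "Suc n"] by force
      then show ?thesis using failure \<eta>2 by (simp add: le_max_iff_disj)
    qed
  qed
  moreover have inc: "incseq (\<lambda>n. \<rho> (Suc n))"
    by (rule incseq_SucI, rule continues_in_mono(1)[OF run_continues])
       (simp_all add: run_\<rho>_pos)
  ultimately obtain r where "(\<lambda>n. \<rho> (Suc n)) \<longlonglongrightarrow> r"
    using incseq_convergent[OF inc, of "max \<rho>1 (\<eta>2 * T)"] by metis
  then show ?thesis by (rule convergentI)
qed

lemma \<Theta>_run_convergent: "convergent (\<lambda>n. \<Theta> (Z (Suc n)))"
proof -
  have dec: "decseq (\<lambda>n. \<Theta> (Z (Suc n)))"
    by (rule decseq_SucI, rule continues_in_mono(2)[OF run_continues])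
       (simp_all add: run_\<rho>_pos)
  then obtain t where "(\<lambda>n. \<Theta> (Z (Suc n))) \<longlonglongrightarrow> t"
    using decseq_convergent[OF dec, of 0] \<Theta>_nonneg by metis
  then show ?thesis by (rule convergentI)
qed

lemma eventually_success:
  "\<forall>\<^sub>F n in sequentially. Z (Suc (Suc n)) = Z (Suc n) + s (Suc n) \<and>
     \<eta>1 * \<rho> (Suc n) / 2 * (norm (s (Suc n)))\<^sup>2 \<le> \<Theta> (Z (Suc n)) - \<Theta> (Z (Suc (Suc n)))"
proof -
  text \<open>A failed step increases \<open>\<rho>\<close> by at least \<open>(\<eta>2 - 1) * \<rho>1\<close>.\<close>
  obtain r where r: "(\<lambda>n. \<rho> (Suc n)) \<longlonglongrightarrow> r" using \<rho>_convergent convergent_def by blast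
  have "(\<lambda>n. \<rho> (Suc (Suc n)) - \<rho> (Suc n)) \<longlonglongrightarrow> r - r"
    by (intro tendsto_diff r) (rule LIMSEQ_Suc[OF r])
  then have "\<forall>\<^sub>F n in sequentially. \<rho> (Suc (Suc n)) - \<rho> (Suc n) < (\<eta>2 - 1) * \<rho>1"
    using \<eta>2 \<rho>1_pos by (intro order_tendstoD(2)) auto
  then show ?thesis
  proof eventually_elim
    case (elim n)
    have "continues_in Z \<rho> s (Suc n)" by (rule run_continues) simp
    then show ?case
    proof (cases rule: continues_in_cases)
      case success
      then show ?thesis by simp
    next
      case failure
      have "(\<eta>2 - 1) * \<rho>1 \<le> (\<eta>2 - 1) * \<rho> (Suc n)"
        using infinite_run_invariant(1)[of "Suc n"] \<eta>2 by (intro mult_left_mono) auto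
      moreover have "\<rho> (Suc (Suc n)) - \<rho> (Suc n) = (\<eta>2 - 1) * \<rho> (Suc n)"
        using failure(3) by (simp add: left_diff_distrib)
      ultimately show ?thesis using elim by linarith
    qed
  qed
qed

text \<open>The test for acceptance bounds the squared step by a fixed multiple of the decrease of
  \<Theta>, and consecutive differences of a convergent sequence tend to 0.\<close>

lemma steps_tendsto_0: "(\<lambda>n. s (Suc n)) \<longlonglongrightarrow> 0"
proof -
  obtain t where t: "(\<lambda>n. \<Theta> (Z (Suc n))) \<longlonglongrightarrow> t" using \<Theta>_run_convergent convergent_def by blast
  have "(\<lambda>n. (\<Theta> (Z (Suc n)) - \<Theta> (Z (Suc (Suc n)))) * (2 / (\<eta>1 * \<rho>1))) \<longlonglongrightarrow> (t - t) * (2 / (\<eta>1 * \<rho>1))"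
    by (intro tendsto_mult tendsto_diff t tendsto_const) (rule LIMSEQ_Suc[OF t])
  then have "(\<lambda>n. (\<Theta> (Z (Suc n)) - \<Theta> (Z (Suc (Suc n)))) * (2 / (\<eta>1 * \<rho>1))) \<longlonglongrightarrow> 0" by simp
  moreover have "\<forall>\<^sub>F n in sequentially. (norm (s (Suc n)))\<^sup>2
      \<le> (\<Theta> (Z (Suc n)) - \<Theta> (Z (Suc (Suc n)))) * (2 / (\<eta>1 * \<rho>1))"
    using eventually_success
  proof eventually_elim
    case (elim n)
    have "\<eta>1 * \<rho>1 / 2 * (norm (s (Suc n)))\<^sup>2 \<le> \<eta>1 * \<rho> (Suc n) / 2 * (norm (s (Suc n)))\<^sup>2"
      using infinite_run_invariant(1)[of "Suc n"] \<eta>1 by (intro mult_right_mono) auto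
    with elim have "\<eta>1 * \<rho>1 / 2 * (norm (s (Suc n)))\<^sup>2 \<le> \<Theta> (Z (Suc n)) - \<Theta> (Z (Suc (Suc n)))"
      by linarith
    then show ?case using \<eta>1 \<rho>1_pos by (simp add: field_simps)
  qed
  ultimately have "(\<lambda>n. (norm (s (Suc n)))\<^sup>2) \<longlonglongrightarrow> 0"
    by (intro tendsto_sandwich[of "\<lambda>_. 0" "\<lambda>n. (norm (s (Suc n)))\<^sup>2" sequentially]) auto
  then show ?thesis by (simp add: tendsto_norm_zero_iff)
qed

text \<open>The inequality between the trial step and any other short step passes to the limit: the
  trial steps vanish and \<rho> converges, so the left side becomes the limit model at the zero
  step.\<close>

lemma accumulation_point_model_local_min:
  assumes "accumulation_point z Z"
  shows "(\<exists>r. model_local_min F H J c z r) \<and> \<Theta> z \<le> \<Theta> z1"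
proof -
  obtain q where q: "strict_mono q" "(Z \<circ> q) \<longlonglongrightarrow> z"
    using assms unfolding accumulation_point_def by blast
  have q1: "\<forall>\<^sub>F n in sequentially. 1 \<le> q n"
    using filterlim_subseq[OF q(1)] by (simp add: filterlim_at_top)
  obtain r where r: "(\<lambda>n. \<rho> (q n)) \<longlonglongrightarrow> r"
    using \<rho>_convergent LIMSEQ_subseq_Suc[OF _ q(1)] unfolding convergent_def by blast
  note s0 = LIMSEQ_subseq_Suc[OF steps_tendsto_0 q(1)]
  have Zq: "(\<lambda>n. Z (q n)) \<longlonglongrightarrow> z" using q(2) by (simp add: o_def)
  have "model z r 0 \<le> model z r v" if "norm v < \<delta>" for v
  proof (rule tendsto_le[OF trivial_limit_sequentially])
    show "(\<lambda>n. model (Z (q n)) (\<rho> (q n)) (s (q n))) \<longlonglongrightarrow> model z r 0"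
      by (intro tendsto_model Zq r s0)
    \<comment> \<open>The competitor is the fixed point \<open>z + v\<close>, seen from the moving
      iterate; its step tends to \<open>v\<close> and is eventually shorter than \<delta>.\<close>
    have "(\<lambda>n. (z + v) - Z (q n)) \<longlonglongrightarrow> (z + v) - z"
      by (intro tendsto_intros Zq)
    then have v: "(\<lambda>n. (z + v) - Z (q n)) \<longlonglongrightarrow> v" by simp
    then show "(\<lambda>n. model (Z (q n)) (\<rho> (q n)) ((z + v) - Z (q n))) \<longlonglongrightarrow> model z r v"
      by (intro tendsto_model Zq r)
    have "\<forall>\<^sub>F n in sequentially. norm ((z + v) - Z (q n)) < \<delta>"
      using tendsto_norm[OF v] that by (rule order_tendstoD(2))
    with q1 show "\<forall>\<^sub>F n in sequentially. model (Z (q n)) (\<rho> (q n)) (s (q n))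
        \<le> model (Z (q n)) (\<rho> (q n)) ((z + v) - Z (q n))"
    proof eventually_elim
      case (elim n)
      then show ?case
        by (intro trial_step_le[OF continues_in_trial_step[OF run_continues]])
           (auto simp: dist_norm norm_minus_commute)
    qed
  qed
  then have "model_local_min F H J c z r" using \<delta>_pos unfolding model_local_min_def by blast
  moreover have "\<Theta> z \<le> \<Theta> z1"
  proof (rule tendsto_le[OF trivial_limit_sequentially])
    show "(\<lambda>n. \<Theta> (Z (q n))) \<longlonglongrightarrow> \<Theta> z"
      by (rule continuous_on_UNIV_tendsto[OF \<Theta>_continuous Zq])
    show "(\<lambda>n. \<Theta> z1) \<longlonglongrightarrow> \<Theta> z1" by simp
    show "\<forall>\<^sub>F n in sequentially. \<Theta> (Z (q n)) \<le> \<Theta> z1"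
      using q1 by eventually_elim (rule infinite_run_invariant)
  qed
  ultimately show ?thesis by blast
qed

end

lemma terminating_run_model_local_min:
  assumes "srpa_terminating_run F H J c I P \<delta> \<Theta> \<eta>1 \<eta>2 z1 \<rho>1 Z \<rho> s k"
  shows "(\<exists>r. model_local_min F H J c (Z k) r) \<and> \<Theta> (Z k) \<le> \<Theta> z1"
proof -
  have "Z 1 = z1" "\<rho> 1 = \<rho>1" "1 \<le> k" "\<And>j. j \<in> {1..<k} \<Longrightarrow> continues_in Z \<rho> s j"
    and stop: "srpa_terminates_in F H J c I P \<delta> Z \<rho> s k"
    using assms unfolding srpa_terminating_run_def by blast+
  then have "\<Theta> (Z k) \<le> \<Theta> z1" using run_invariant by blast
  then show ?thesis using terminates_in_model_local_min[OF stop] by blast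
qed

end

section \<open>The layered penalty function\<close>

locale layered_network =
  fixes L :: nat
    and layer :: "'m::finite \<Rightarrow> nat"
    and g :: "real^'m \<Rightarrow> real"
    and \<psi> :: "nat \<Rightarrow> (real^'n::finite) \<times> (real^'m) \<Rightarrow> real^'m"
    and lam :: real
    and \<beta> :: "nat \<Rightarrow> real"
  assumes layers: "layer ` UNIV = {1..L}"
    and g_nonneg: "0 \<le> g u"
    and g_twice: "twice_dir_differentiable g"
    and g_smooth: "smooth g"
    and g_convex: "convex_on UNIV g"
    and psi_map: "l \<in> {1..L} \<Longrightarrow> layer_map layer l (\<psi> (l - 1))"
    and psi_lipschitz: "l \<in> {1..L} \<Longrightarrow> locally_lipschitz (\<psi> (l - 1))"
    and psi_twice: "l \<in> {1..L} \<Longrightarrow> twice_dir_differentiable (\<psi> (l - 1))"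
    and lam_pos: "0 < lam"
    and beta_pos: "l \<in> {1..L} \<Longrightarrow> 0 < \<beta> l"
begin

section \<open>Residuals and their linearization\<close>

abbreviation "F \<equiv> F_fun g lam"
abbreviation "\<Theta> \<equiv> Theta L layer g lam \<beta> \<psi>"
abbreviation "bup \<equiv> blocks_upto layer"

text \<open>The constraint violation of all layers as one vector. The maps are applied to
  \<open>z\<close> without truncation, since they ignore the later blocks.\<close>

definition residual :: "(real^'n) \<times> (real^'m) \<Rightarrow> real^'m" where
  "residual z = (\<chi> i. snd z $ i - \<psi> (layer i - 1) z $ i)"

definition lin_residual :: "(real^'n) \<times> (real^'m) \<Rightarrow> (real^'n) \<times> (real^'m) \<Rightarrow> real^'m" where
  "lin_residual z d = (\<chi> i. snd d $ i - dir_deriv (\<psi> (layer i - 1)) z d $ i)"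

lemma layer_in: "layer i \<in> {1..L}"
  using layers by blast

lemma layer_neq_0 [simp]: "layer i \<noteq> 0" and layer_le: "layer i \<le> L"
  using layer_in[of i] by auto

text \<open>Truncation is idempotent, so the equation in \<open>layer_map\<close> gives the same
  value for both arguments.\<close>

lemma psi_bup:
  assumes "l \<in> {1..L}"
  shows "\<psi> (l - 1) (\<theta>, bup (l - 1) u) = \<psi> (l - 1) (\<theta>, u)"
proof -
  have "bup (l - 1) (bup (l - 1) u) = bup (l - 1) u"
    by (simp add: blocks_upto_def vec_eq_iff)
  then show ?thesis
    using psi_map[OF assms] unfolding layer_map_def by metis
qed

lemma psi_component_0:
  assumes "l \<in> {1..L}" "layer i \<noteq> l"
  shows "\<psi> (l - 1) z $ i = 0"
proof -
  have "\<psi> (l - 1) z = block layer l (\<psi> (l - 1) (fst z, bup (l - 1) (snd z)))"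
    using psi_map[OF assms(1)] unfolding layer_map_def by (metis prod.collapse)
  then show ?thesis using assms(2) by (simp add: block_def)
qed

lemma c_fun_eq: "c_fun layer \<beta> \<psi> i z = \<beta> (layer i) * residual z $ i"
  using psi_bup[OF layer_in[of i], of "fst z" "snd z"] by (simp add: c_fun_def residual_def)

lemma Theta_eq: "\<Theta> z = F z + (\<Sum>i\<in>UNIV. \<beta> (layer i) * \<bar>residual z $ i\<bar>)"
  using beta_pos[OF layer_in]
  by (subst Theta_decomposition[OF layers psi_map beta_pos, where A = "{}"])
    (simp_all add: H_fun_def c_fun_eq abs_mult less_imp_le)

lemma psi_has_dir_deriv:
  "has_dir_deriv (\<psi> (layer i - 1)) z d (dir_deriv (\<psi> (layer i - 1)) z d)"
  using twice_dir_differentiable_dir_deriv[OF psi_twice[OF layer_in]] .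

lemma bup_linear: "bup l (u + t *\<^sub>R v) = bup l u + t *\<^sub>R bup l v"
  by (simp add: blocks_upto_def vec_eq_iff)

text \<open>The two difference quotients agree for every \<open>t\<close>. This connects the
  derivative bounds, assumed for truncated arguments, with derivatives at \<open>z\<close>
  itself.\<close>

lemma psi_dir_deriv_bup:
  assumes "l \<in> {1..L}"
  shows "dir_deriv (\<psi> (l - 1)) (fst z, bup (l - 1) (snd z)) (fst d, bup (l - 1) (snd d))
    = dir_deriv (\<psi> (l - 1)) z d"
proof -
  have "\<psi> (l - 1) ((fst z, bup (l - 1) (snd z)) + t *\<^sub>R (fst d, bup (l - 1) (snd d)))
      = \<psi> (l - 1) (z + t *\<^sub>R d)" for t
    using psi_bup[OF assms, of "fst (z + t *\<^sub>R d)" "snd (z + t *\<^sub>R d)"]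
      by (simp add: bup_linear plus_prod_def)
  from this[of 0] this show ?thesis by (simp add: dir_deriv_def has_dir_deriv_def)
qed

lemma psi_dir_deriv_cong:
  assumes "l \<in> {1..L}" "fst d = fst d'" "\<And>i. layer i < l \<Longrightarrow> snd d $ i = snd d' $ i"
  shows "dir_deriv (\<psi> (l - 1)) z d = dir_deriv (\<psi> (l - 1)) z d'"
proof -
  have "bup (l - 1) (snd d) = bup (l - 1) (snd d')"
    using assms(1,3) by (auto simp: blocks_upto_def vec_eq_iff)
  then show ?thesis
    using psi_dir_deriv_bup[OF assms(1), of z d] psi_dir_deriv_bup[OF assms(1), of z d'] assms(2)
      by simp
qed

lemma psi_dir_deriv_component_0:
  assumes "l \<in> {1..L}" "layer i \<noteq> l"
  shows "dir_deriv (\<psi> (l - 1)) z d $ i = 0"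
proof -
  have "((\<lambda>t. ((\<psi> (l - 1) (z + t *\<^sub>R d) - \<psi> (l - 1) z) /\<^sub>R t) $ i)
      \<longlongrightarrow> dir_deriv (\<psi> (l - 1)) z d $ i) (at_right 0)"
    using twice_dir_differentiable_dir_deriv[OF psi_twice[OF assms(1)]] unfolding has_dir_deriv_def
    by (rule tendsto_vec_nth)
  then have "((\<lambda>t. 0) \<longlongrightarrow> dir_deriv (\<psi> (l - 1)) z d $ i) (at_right (0::real))"
    by (simp add: psi_component_0[OF assms] del: One_nat_def)
  then show ?thesis by (simp add: tendsto_const_iff)
qed

lemma residual_has_dir_deriv:
  "has_dir_deriv (\<lambda>z. residual z $ i) z d (lin_residual z d $ i)"
proof -
  have "((\<lambda>t. snd d $ i - ((\<psi> (layer i - 1) (z + t *\<^sub>R d) - \<psi> (layer i - 1) z) /\<^sub>R t) $ i)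
      \<longlongrightarrow> lin_residual z d $ i) (at_right 0)"
    unfolding lin_residual_def vec_lambda_beta
    by (intro tendsto_intros tendsto_vec_nth psi_has_dir_deriv[unfolded has_dir_deriv_def])
  moreover have "\<forall>\<^sub>F t in at_right 0. snd d $ i - ((\<psi> (layer i - 1) (z + t *\<^sub>R d) - \<psi> (layer i - 1) z) /\<^sub>R t) $ i
     = (residual (z + t *\<^sub>R d) $ i - residual z $ i) /\<^sub>R t"
    using eventually_at_right_less[of 0] by eventually_elim (simp add: residual_def field_simps)
  ultimately show ?thesis unfolding has_dir_deriv_def by (rule Lim_transform_eventually)
qed

lemma Theta_has_dir_deriv:
  "has_dir_deriv \<Theta> z d (grad F z \<bullet> d + (\<Sum>i\<in>UNIV. \<beta> (layer i) * abs_dir (residual z $ i) (lin_residual z d $ i)))"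
  unfolding Theta_eq
  by (intro has_dir_deriv_add has_dir_deriv_sum has_dir_deriv_cmult has_dir_deriv_abs
      residual_has_dir_deriv smooth_has_dir_deriv F_fun_smooth g_smooth)

lemmas Theta_dir_deriv = dir_derivI[OF Theta_has_dir_deriv]

lemma lin_residual_0: "lin_residual z 0 = 0"
  by (simp add: lin_residual_def vec_eq_iff dir_derivI[OF has_dir_deriv_0])

text \<open>The linearized constraints are triangular: the derivative in a layer depends only on
  earlier blocks, so the blocks of the direction can be solved for one after the other.\<close>

lemma lin_residual_surj:
  obtains d where "fst d = e" "lin_residual z d = v"
proof -
  have "\<exists>y. \<forall>i. layer i \<le> l \<longrightarrow> lin_residual z (e, y) $ i = v $ i" for l
  proof (induction l)
    case 0
    then show ?case by (auto simp: not_less)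
  next
    case (Suc l)
    then obtain y where y: "\<And>i. layer i \<le> l \<Longrightarrow> lin_residual z (e, y) $ i = v $ i" by blast
    \<comment> \<open>The first \<open>l\<close> blocks are kept. On the next block the prescribed
      residual is added to the derivative that those blocks determine; entries in still later layers
      are provisional.\<close>
    define y' where "y' = (\<chi> i. if layer i \<le> l then y $ i else v $ i + dir_deriv (\<psi> (layer i - 1)) z (e, y) $ i)"
    have "lin_residual z (e, y') $ i = v $ i" if i: "layer i \<le> Suc l" for i
    proof -
      have "dir_deriv (\<psi> (layer i - 1)) z (e, y') = dir_deriv (\<psi> (layer i - 1)) z (e, y)"
        using i by (intro psi_dir_deriv_cong[OF layer_in]) (auto simp: y'_def)
      then show ?thesis using y[of i] by (auto simp: lin_residual_def y'_def)
    qed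
    then show ?case by blast
  qed
  from this[of L] obtain y where "lin_residual z (e, y) = v"
    using layer_le by (auto simp: vec_eq_iff)
  then show ?thesis using that[of "(e, y)"] by simp
qed

lemma Theta_nonneg_parts: "0 \<le> F z" "0 \<le> \<beta> (layer i) * \<bar>residual z $ i\<bar>"
  using g_nonneg[of "snd z"] lam_pos beta_pos[OF layer_in[of i]]
  by (simp_all add: F_fun_def)

section \<open>Regularity of the decomposition and bounded level sets\<close>

lemma residual_continuous: "continuous_on S (\<lambda>z. residual z $ i)"
  unfolding residual_def
  using locally_lipschitz_continuous_on[OF psi_lipschitz[OF layer_in[of i]], of S]
  by (auto intro!: continuous_intros simp del: One_nat_def)

lemma c_fun_smooth:
  assumes "smooth (\<lambda>z. \<psi> (layer i - 1) z $ i)"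
  shows "smooth (c_fun layer \<beta> \<psi> i)"
proof (rule smoothI(1))
  let ?p = "\<lambda>z. \<psi> (layer i - 1) z $ i" and ?b = "\<beta> (layer i)"
  let ?G = "\<lambda>z. ?b *\<^sub>R (0, axis i 1) + (- ?b) *\<^sub>R grad ?p z"
  fix z
  have "((\<lambda>z. ?b * (snd z $ i - ?p z)) has_derivative (\<lambda>h. ?b * (snd h $ i - h \<bullet> grad ?p z))) (at z)"
    by (intro has_derivative_mult_right has_derivative_diff smooth_has_derivative[OF assms]
        bounded_linear.has_derivative[OF bounded_linear_vec_nth] has_derivative_snd has_derivative_ident)
  moreover have "c_fun layer \<beta> \<psi> i = (\<lambda>z. ?b * (snd z $ i - ?p z))"
    by (simp add: fun_eq_iff c_fun_eq residual_def)
  moreover have "(\<lambda>h. ?b * (snd h $ i - h \<bullet> grad ?p z)) = (\<lambda>h. h \<bullet> ?G z)"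
    by (simp add: fun_eq_iff inner_add_right inner_diff_right inner_prod_def inner_axis algebra_simps)
  ultimately show "GDERIV (c_fun layer \<beta> \<psi> i) z :> ?G z"
    unfolding gderiv_def by (simp only:)
next
  show "locally_lipschitz (\<lambda>z. \<beta> (layer i) *\<^sub>R (0, axis i 1) + (- \<beta> (layer i)) *\<^sub>R grad (\<lambda>z. \<psi> (layer i - 1) z $ i) z)"
    using assms by (intro locally_lipschitz_affine) (simp add: smooth_def)
qed

lemma H_fun_continuous: "continuous_on S (H_fun layer \<beta> \<psi> A)"
  unfolding H_fun_def c_fun_eq by (intro continuous_intros residual_continuous)

lemma H_fun_nonneg: "0 \<le> H_fun layer \<beta> \<psi> A z"
  by (simp add: H_fun_def sum_nonneg)

text \<open>On a level set the term with \<open>lam\<close> bounds the first component and the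
  penalties bound the residuals. Each block is its residual plus the image of earlier, already
  bounded data under a continuous map, so the bound propagates through the layers.\<close>

lemma level_set_bounded: "bounded {z. \<Theta> z \<le> \<gamma>}"
proof -
  let ?S = "{z. \<Theta> z \<le> \<gamma>}"
  have F_le: "F z \<le> \<gamma>" if "z \<in> ?S" for z
  proof -
    have "0 \<le> (\<Sum>i\<in>UNIV. \<beta> (layer i) * \<bar>residual z $ i\<bar>)"
      by (intro sum_nonneg Theta_nonneg_parts)
    then show ?thesis using that by (simp add: Theta_eq)
  qed
  have fst_le: "norm (fst z) \<le> sqrt (\<gamma> / lam)" if "z \<in> ?S" for z
  proof (rule real_le_rsqrt)
    show "(norm (fst z))\<^sup>2 \<le> \<gamma> / lam"
      using F_le[OF that] g_nonneg[of "snd z"] lam_pos by (simp add: F_fun_def field_simps)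
  qed
  have res_le: "\<bar>residual z $ i\<bar> \<le> \<gamma> / \<beta> (layer i)" if "z \<in> ?S" for z i
  proof -
    have "\<beta> (layer i) * \<bar>residual z $ i\<bar> \<le> (\<Sum>i\<in>UNIV. \<beta> (layer i) * \<bar>residual z $ i\<bar>)"
      using Theta_nonneg_parts(2) by (intro member_le_sum) auto
    then have "\<beta> (layer i) * \<bar>residual z $ i\<bar> \<le> \<gamma>"
      using that Theta_nonneg_parts(1)[of z] by (simp add: Theta_eq)
    then show ?thesis using beta_pos[OF layer_in[of i]] by (simp add: field_simps)
  qed
  have "\<exists>B. \<forall>z\<in>?S. norm (bup l (snd z)) \<le> B" for l
  proof (induction l)
    case 0
    have "bup 0 (snd z) = 0" for z :: "(real^'n) \<times> (real^'m)"
      by (auto simp: blocks_upto_def vec_eq_iff)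
    then show ?case by (metis norm_zero order_refl)
  next
    case (Suc l)
    then obtain B where B: "\<And>z. z \<in> ?S \<Longrightarrow> norm (bup l (snd z)) \<le> B" by blast
    show ?case
    proof (cases "Suc l \<le> L")
      case False
      then have "bup (Suc l) u = bup l u" for u using layer_le
        by (auto simp: blocks_upto_def vec_eq_iff) (metis le_trans not_less_eq_eq)
      then show ?thesis using B by (intro exI[of _ B]) auto
    next
      case True
      then have l: "Suc l \<in> {1..L}" by simp
      have "compact (\<psi> l ` cball 0 (sqrt (\<gamma> / lam) + B))"
        using psi_lipschitz[OF l] by (intro compact_continuous_image locally_lipschitz_continuous_on) auto
      then have "bounded (\<psi> l ` cball 0 (sqrt (\<gamma> / lam) + B))" by (rule compact_imp_bounded)
      then obtain C where C: "\<forall>x\<in>cball 0 (sqrt (\<gamma> / lam) + B). norm (\<psi> l x) \<le> C"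
        unfolding bounded_iff ball_simps by (rule exE)
      have "norm (bup (Suc l) (snd z)) \<le> B + (\<Sum>i\<in>UNIV. \<gamma> / \<beta> (layer i)) + C" if z: "z \<in> ?S" for z
      proof -
        \<comment> \<open>Needed for the coordinates outside the block, where the vector is 0; a
          point of the level set forces the bound to be nonnegative.\<close>
        have res0: "0 \<le> \<gamma> / \<beta> (layer i)" for i using res_le[OF z, of i] by linarith
        have "(fst z, bup l (snd z)) \<in> cball 0 (sqrt (\<gamma> / lam) + B)"
          using fst_le[OF z] B[OF z] norm_Pair_le[of "fst z" "bup l (snd z)"] by simp
        with C have "norm (\<psi> l (fst z, bup l (snd z))) \<le> C" by (rule bspec)
        then have psi: "norm (\<psi> l z) \<le> C"
          using psi_bup[OF l, of "fst z" "snd z"] by simp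
        \<comment> \<open>The new block is residual plus \<open>\<psi> l z\<close>, and
          \<open>\<psi> l z\<close> vanishes outside that block.\<close>
        have "bup (Suc l) (snd z) = bup l (snd z) + block layer (Suc l) (residual z) + \<psi> l z"
          using psi_component_0[OF l]
          by (auto simp: vec_eq_iff blocks_upto_def block_def residual_def)
        then have "norm (bup (Suc l) (snd z))
            \<le> norm (bup l (snd z)) + norm (block layer (Suc l) (residual z)) + norm (\<psi> l z)"
          by (metis norm_triangle_le norm_triangle_ineq add_right_mono)
        moreover have "norm (block layer (Suc l) (residual z)) \<le> (\<Sum>i\<in>UNIV. \<gamma> / \<beta> (layer i))"
        proof (rule order_trans[OF norm_le_l1_cart sum_mono])
          fix i
          show "\<bar>block layer (Suc l) (residual z) $ i\<bar> \<le> \<gamma> / \<beta> (layer i)"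
            using res_le[OF z, of i] res0[of i] by (auto simp: block_def)
        qed
        ultimately show ?thesis using B[OF z] psi by linarith
      qed
      then show ?thesis by blast
    qed
  qed
  from this[of L] obtain B where B: "\<And>z. z \<in> ?S \<Longrightarrow> norm (bup L (snd z)) \<le> B" by blast
  have "bup L u = u" for u using layer_le by (auto simp: blocks_upto_def vec_eq_iff)
  then have "norm z \<le> sqrt (\<gamma> / lam) + B" if "z \<in> ?S" for z
    using fst_le[OF that] B[OF that] norm_Pair_le[of "fst z" "snd z"] by simp
  then show ?thesis unfolding bounded_iff by blast
qed

section \<open>Second-order behaviour of \<open>F\<close>, the residual and \<Theta>\<close>

lemma F_above_tangent: "F z + grad F z \<bullet> d \<le> F (z + d)"
proof -
  have "g (snd z) + grad g (snd z) \<bullet> snd d \<le> g (snd z + snd d)"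
    by (intro convex_on_dir_deriv_le g_convex smooth_has_dir_deriv g_smooth)
  moreover have "(norm (fst z + fst d))\<^sup>2 = (norm (fst z))\<^sup>2 + 2 * (fst z \<bullet> fst d) + (norm (fst d))\<^sup>2"
    by (simp add: power2_norm_eq_inner inner_add inner_commute)
  then have "lam * (norm (fst z))\<^sup>2 + 2 * lam * (fst z \<bullet> fst d) \<le> lam * (norm (fst z + fst d))\<^sup>2"
    using lam_pos by (simp add: distrib_left)
  ultimately show ?thesis
    by (simp add: F_fun_smooth[OF g_smooth] inner_prod_def) (simp add: F_fun_def)
qed

lemma F_dir_deriv: "dir_deriv F z d = grad F z \<bullet> d"
  by (intro dir_derivI smooth_has_dir_deriv F_fun_smooth(1) g_smooth)

text \<open>The quadratic term has the constant second-order quotient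
  \<open>2 * lam * (norm (fst d))\<^sup>2\<close>; the rest is the quotient of
  \<open>g\<close>.\<close>

lemma F_has_dir_deriv2: "\<exists>D. has_dir_deriv2 F z d D"
proof -
  obtain E where E: "has_dir_deriv2 g (snd z) (snd d) E"
    using g_twice unfolding twice_dir_differentiable_def by blast
  have g': "dir_deriv g (snd z) (snd d) = grad g (snd z) \<bullet> snd d"
    by (intro dir_derivI smooth_has_dir_deriv g_smooth)
  have F': "dir_deriv F z d = 2 * lam * (fst z \<bullet> fst d) + grad g (snd z) \<bullet> snd d"
    by (simp add: F_dir_deriv F_fun_smooth(2)[OF g_smooth] inner_prod_def)
  have "((\<lambda>t. (g (snd z + t *\<^sub>R snd d) - g (snd z) - t *\<^sub>R dir_deriv g (snd z) (snd d)) /\<^sub>R (t\<^sup>2 / 2)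
       + 2 * lam * (norm (fst d))\<^sup>2) \<longlongrightarrow> E + 2 * lam * (norm (fst d))\<^sup>2) (at_right 0)"
    by (intro tendsto_intros E[unfolded has_dir_deriv2_def])
  moreover have "\<forall>\<^sub>F t in at_right 0. (g (snd z + t *\<^sub>R snd d) - g (snd z) - t *\<^sub>R dir_deriv g (snd z) (snd d)) /\<^sub>R (t\<^sup>2 / 2)
       + 2 * lam * (norm (fst d))\<^sup>2 = (F (z + t *\<^sub>R d) - F z - t *\<^sub>R dir_deriv F z d) /\<^sub>R (t\<^sup>2 / 2)"
    using eventually_at_right_less[of 0]
  proof eventually_elim
    case (elim t)
    have "(norm (fst z + t *\<^sub>R fst d))\<^sup>2 = (norm (fst z))\<^sup>2 + 2 * t * (fst z \<bullet> fst d) + t\<^sup>2 * (norm (fst d))\<^sup>2"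
      unfolding power2_norm_eq_inner by (simp add: inner_add inner_commute power2_eq_square)
    with elim show ?case
      by (simp add: F' g') (simp add: F_fun_def field_simps)
  qed
  ultimately show ?thesis unfolding has_dir_deriv2_def by (blast intro: Lim_transform_eventually)
qed

lemma psi_has_dir_deriv2: "\<exists>E. has_dir_deriv2 (\<psi> (layer i - 1)) z d E"
  using psi_twice[OF layer_in[of i]] unfolding twice_dir_differentiable_def by blast

text \<open>When the residual and its linearization vanish, what remains along the ray is minus the
  second-order remainder of the layer map.\<close>

lemma residual_second_order:
  assumes "residual z $ i = 0" "lin_residual z d $ i = 0"
  shows "\<exists>E. ((\<lambda>t. residual (z + t *\<^sub>R d) $ i /\<^sub>R (t\<^sup>2 / 2)) \<longlongrightarrow> E) (at_right 0)"
proof -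
  let ?p = "\<psi> (layer i - 1)"
  obtain E where "has_dir_deriv2 ?p z d E" using psi_has_dir_deriv2 by blast
  then have "((\<lambda>t. - ((?p (z + t *\<^sub>R d) - ?p z - t *\<^sub>R dir_deriv ?p z d) /\<^sub>R (t\<^sup>2 / 2)) $ i)
      \<longlongrightarrow> - E $ i) (at_right 0)"
    unfolding has_dir_deriv2_def by (intro tendsto_intros tendsto_vec_nth)
  moreover have "- ((?p (z + t *\<^sub>R d) - ?p z - t *\<^sub>R dir_deriv ?p z d) /\<^sub>R (t\<^sup>2 / 2)) $ i
      = residual (z + t *\<^sub>R d) $ i /\<^sub>R (t\<^sup>2 / 2)" for t
  proof -
    have "snd z $ i = ?p z $ i" "snd d $ i = dir_deriv ?p z d $ i"
      using assms by (simp_all add: residual_def lin_residual_def)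
    then have "residual (z + t *\<^sub>R d) $ i = - ((?p (z + t *\<^sub>R d) - ?p z - t *\<^sub>R dir_deriv ?p z d) $ i)"
      by (simp add: residual_def)
    then show ?thesis by (simp only: vector_scaleR_component scaleR_minus_right)
  qed
  ultimately show ?thesis by auto
qed

text \<open>The residuals are of order t^2 along \<open>d\<close>, so their absolute values divided
  by t^2 converge by continuity. Every quotient is nonnegative, because the penalties are and
  because \<open>F\<close> lies above its tangent, which is flat along \<open>d\<close>.\<close>

lemma Theta_has_dir_deriv2:
  assumes r: "residual z = 0" and d: "lin_residual z d = 0" and D: "grad F z \<bullet> d = 0"
  shows "\<exists>D\<ge>0. has_dir_deriv2 \<Theta> z d D"
proof -
  obtain E where E: "has_dir_deriv2 F z d E" using F_has_dir_deriv2 by blast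
  have "\<forall>i. \<exists>e. ((\<lambda>t. residual (z + t *\<^sub>R d) $ i /\<^sub>R (t\<^sup>2 / 2)) \<longlongrightarrow> e) (at_right 0)"
    using residual_second_order r d by simp
  from choice[OF this] obtain e where e: "((\<lambda>t. residual (z + t *\<^sub>R d) $ i /\<^sub>R (t\<^sup>2 / 2))
      \<longlongrightarrow> e i) (at_right 0)" for i
    by fast
  have F': "dir_deriv F z d = 0"
    using D by (simp add: F_dir_deriv)
  have T': "dir_deriv \<Theta> z d = 0"
    using D r d by (simp add: Theta_dir_deriv abs_dir_def)
  let ?q = "\<lambda>t. (F (z + t *\<^sub>R d) - F z - t *\<^sub>R dir_deriv F z d) /\<^sub>R (t\<^sup>2 / 2)
      + (\<Sum>i\<in>UNIV. \<beta> (layer i) * \<bar>residual (z + t *\<^sub>R d) $ i /\<^sub>R (t\<^sup>2 / 2)\<bar>)"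
  let ?D = "E + (\<Sum>i\<in>UNIV. \<beta> (layer i) * \<bar>e i\<bar>)"
  have q: "(?q \<longlongrightarrow> ?D) (at_right 0)"
    by (intro tendsto_intros e E[unfolded has_dir_deriv2_def])
  have eq: "?q t = (\<Theta> (z + t *\<^sub>R d) - \<Theta> z - t *\<^sub>R dir_deriv \<Theta> z d) /\<^sub>R (t\<^sup>2 / 2)" for t
    by (simp add: T' F' Theta_eq r abs_mult sum_distrib_left algebra_simps)
  have "0 \<le> ?q t" for t
  proof -
    have "F z \<le> F (z + t *\<^sub>R d)" using F_above_tangent[of z "t *\<^sub>R d"] D by simp
    then show ?thesis using beta_pos[OF layer_in]
      by (auto intro!: add_nonneg_nonneg sum_nonneg mult_nonneg_nonneg simp: F' less_imp_le)
  qed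
  then have "0 \<le> ?D" using q by (intro tendsto_lowerbound[OF q]) auto
  moreover have "has_dir_deriv2 \<Theta> z d ?D" using q unfolding eq has_dir_deriv2_def .
  ultimately show ?thesis by blast
qed

end

section \<open>Exactness of the penalty\<close>

text \<open>The derivative bounds hold only on a level set, so they are stated at one fixed point
  \<open>z\<close>; the locale is instantiated once that point is known to lie in the level
  set.\<close>

locale exact_penalty = layered_network L layer g \<psi> lam \<beta>
  for L :: nat and layer :: "'m::finite \<Rightarrow> nat" and g and \<psi> :: "nat \<Rightarrow> (real^'n::finite) \<times> (real^'m) \<Rightarrow> real^'m"
    and lam \<beta> +
  fixes K :: "nat \<Rightarrow> real" and Kg :: real and z :: "(real^'n) \<times> (real^'m)"
  assumes K_pos: "l \<in> {1..L - 1} \<Longrightarrow> 0 < K l"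
    and g_deriv_bound: "\<bar>dir_deriv g (snd z) d\<^sub>u - dir_deriv g (snd z) d\<^sub>u'\<bar> \<le> Kg * norm (d\<^sub>u - d\<^sub>u')"
    and Kg_pos: "0 < Kg"
    and psi_deriv_bound: "l \<in> {2..L} \<Longrightarrow>
          norm (dir_deriv (\<psi> (l - 1)) (fst z, blocks_upto layer (l - 1) (snd z))
                  (d\<^sub>\<theta>, blocks_upto layer (l - 1) d\<^sub>u)
              - dir_deriv (\<psi> (l - 1)) (fst z, blocks_upto layer (l - 1) (snd z))
                  (d\<^sub>\<theta>, blocks_upto layer (l - 1) d\<^sub>u'))
            \<le> K (l - 1) * norm (blocks_upto layer (l - 1) d\<^sub>u - blocks_upto layer (l - 1) d\<^sub>u')"
    and beta_large: "l \<in> {1..L} \<Longrightarrow> \<beta> l > Kg * (\<Prod>j=l+1..L. 1 + K (j - 1))"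
begin

text \<open>The largest amplification of a change in the linearized residual of layer
  \<open>l\<close> on its way through the later layers into the derivative of \<open>g\<close>, as
  far as the constants control it.\<close>

abbreviation "gain l \<equiv> Kg * (\<Prod>j=l+1..L. 1 + K (j - 1))"

lemma bup_0: "bup 0 u = 0"
  by (auto simp: blocks_upto_def vec_eq_iff)

lemma psi_dir_deriv_diff:
  assumes "Suc l \<le> L" "fst d = fst d'"
  shows "norm (dir_deriv (\<psi> l) z d - dir_deriv (\<psi> l) z d') \<le> K l * norm (bup l (snd d - snd d'))"
\<comment> \<open>The first map depends on the first component alone, so both sides vanish whatever
  the value of \<open>K 0\<close>.\<close>
proof (cases "l = 0")
  case True
  have "dir_deriv (\<psi> (Suc 0 - 1)) z d = dir_deriv (\<psi> (Suc 0 - 1)) z d'"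
    by (rule psi_dir_deriv_cong) (use assms True in auto)
  then show ?thesis using True by (simp add: bup_0)
next
  case False
  have l: "Suc l \<in> {1..L}" "Suc l \<in> {2..L}" using assms False by auto
  have "bup l (snd d - snd d') = bup l (snd d) - bup l (snd d')"
    by (simp add: blocks_upto_def vec_eq_iff)
  then show ?thesis
    using psi_deriv_bound[OF l(2), of "fst d" "snd d" "snd d'"] psi_dir_deriv_bup[OF l(1), of z d]
      psi_dir_deriv_bup[OF l(1), of z d'] assms(2) by simp
qed

text \<open>A discrete Gronwall argument: passing to the next layer multiplies the accumulated
  difference by at most \<open>1 + K l\<close> and adds the change of the residual in the new
  block.\<close>

lemma bup_diff_bound:
  assumes "l \<le> L" "fst d = fst d'"
  shows "norm (bup l (snd d - snd d')) \<le>
    (\<Sum>i | layer i \<le> l. \<bar>lin_residual z d $ i - lin_residual z d' $ i\<bar> * (\<Prod>j=layer i+1..l. 1 + K (j - 1)))"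
  using assms(1)
proof (induction l)
  case 0
  then show ?case by (simp add: bup_0)
next
  case (Suc l)
  let ?e = "snd d - snd d'" and ?w = "lin_residual z d - lin_residual z d'"
  let ?s = "\<lambda>l. (\<Sum>i | layer i \<le> l. \<bar>lin_residual z d $ i - lin_residual z d' $ i\<bar> * (\<Prod>j=layer i+1..l. 1 + K (j - 1)))"
  have l: "Suc l \<in> {1..L}" using Suc by simp
  have "bup (Suc l) ?e = bup l ?e + block layer (Suc l) ?w + (dir_deriv (\<psi> l) z d - dir_deriv (\<psi> l) z d')"
    using psi_dir_deriv_component_0[OF l]
    by (auto simp: vec_eq_iff blocks_upto_def block_def lin_residual_def)
  then have "norm (bup (Suc l) ?e) \<le> norm (bup l ?e) + norm (block layer (Suc l) ?w)
      + norm (dir_deriv (\<psi> l) z d - dir_deriv (\<psi> l) z d')"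
    by (metis norm_triangle_le norm_triangle_ineq add_right_mono)
  also have "\<dots> \<le> (1 + K l) * norm (bup l ?e) + norm (block layer (Suc l) ?w)"
    using psi_dir_deriv_diff[of l d d'] Suc.prems assms(2) by (simp add: algebra_simps)
  also have "(1 + K l) * norm (bup l ?e) \<le> (1 + K l) * ?s l"
  proof (cases "l = 0")
    case True
    then show ?thesis by (simp add: bup_0)
  next
    case False
    then have "0 < K l" using Suc.prems by (intro K_pos) auto
    then show ?thesis using Suc by (intro mult_left_mono) auto
  qed
  \<comment> \<open>The upper index \<open>Suc l\<close> of the extended product contributes exactly
    \<open>1 + K l\<close>. For coordinates in the new block the product is empty and equals
    1.\<close>
  also have "(1 + K l) * ?s l = (\<Sum>i | layer i \<le> l. \<bar>?w $ i\<bar> * (\<Prod>j=layer i+1..Suc l. 1 + K (j - 1)))"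
    unfolding sum_distrib_left by (rule sum.cong) (auto simp: prod.nat_ivl_Suc')
  also have "norm (block layer (Suc l) ?w) \<le> (\<Sum>i\<in>UNIV. \<bar>block layer (Suc l) ?w $ i\<bar>)"
    by (rule norm_le_l1_cart)
  also have "\<dots> = (\<Sum>i | layer i = Suc l. \<bar>?w $ i\<bar> * (\<Prod>j=layer i+1..Suc l. 1 + K (j - 1)))"
    by (rule sum.mono_neutral_cong_right) (auto simp: block_def)
  also have "(\<Sum>i | layer i \<le> l. \<bar>?w $ i\<bar> * (\<Prod>j=layer i+1..Suc l. 1 + K (j - 1))) + \<dots>
      = (\<Sum>i\<in>{i. layer i \<le> l} \<union> {i. layer i = Suc l}. \<bar>?w $ i\<bar> * (\<Prod>j=layer i+1..Suc l. 1 + K (j - 1)))"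
    by (rule sum.union_disjoint[symmetric]) auto
  also have "{i. layer i \<le> l} \<union> {i. layer i = Suc l} = {i. layer i \<le> Suc l}" by auto
  finally show ?case by simp
qed

text \<open>With equal first components only the derivative of \<open>g\<close> differs; its
  Lipschitz bound is combined with the Gronwall estimate at the last layer, where truncation is the
  identity.\<close>

lemma F_deriv_diff:
  assumes "fst d = fst d'"
  shows "grad F z \<bullet> d \<le> grad F z \<bullet> d' +
    (\<Sum>i\<in>UNIV. gain (layer i) * \<bar>lin_residual z d $ i - lin_residual z d' $ i\<bar>)"
proof -
  have "dir_deriv g (snd z) v = grad g (snd z) \<bullet> v" for v
    by (intro dir_derivI smooth_has_dir_deriv g_smooth)
  then have "grad F z \<bullet> d \<le> grad F z \<bullet> d' + Kg * norm (snd d - snd d')"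
    using g_deriv_bound[of "snd d" "snd d'"] assms
    by (simp add: F_fun_smooth(2)[OF g_smooth] inner_prod_def)
  also have "snd d - snd d' = bup L (snd d - snd d')"
    using layer_le by (simp add: blocks_upto_def vec_eq_iff)
  also have "Kg * norm \<dots> \<le> Kg * (\<Sum>i\<in>UNIV. \<bar>lin_residual z d $ i - lin_residual z d' $ i\<bar> * (\<Prod>j=layer i+1..L. 1 + K (j - 1)))"
    using bup_diff_bound[OF order_refl assms] Kg_pos layer_le by (intro mult_left_mono) auto
  finally show ?thesis by (simp add: sum_distrib_left mult_ac)
qed

lemma zero_if_weighted_sum_nonneg:
  assumes "0 \<le> (\<Sum>i\<in>UNIV. gain (layer i) * \<bar>w $ i\<bar>) - (\<Sum>i\<in>UNIV. \<beta> (layer i) * \<bar>w $ i\<bar>)"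
  shows "w = 0"
proof -
  let ?f = "\<lambda>i. (\<beta> (layer i) - gain (layer i)) * \<bar>w $ i\<bar>"
  have nn: "0 \<le> ?f i" for i
    using beta_large[OF layer_in[of i]] by (intro mult_nonneg_nonneg) auto
  have "sum ?f UNIV \<le> 0" using assms by (simp add: left_diff_distrib sum_subtractf)
  then have "sum ?f UNIV = 0" using nn by (meson antisym sum_nonneg)
  then have "?f i = 0" for i using nn by (simp add: sum_nonneg_eq_0_iff)
  then have "w $ i = 0" for i using beta_large[OF layer_in[of i]]
    by (metis abs_eq_0_iff diff_gt_0_iff_gt less_irrefl mult_eq_0_iff)
  then show ?thesis by (simp add: vec_eq_iff)
qed

text \<open>The direction that cancels the residual to first order, with zero first component,
  lowers the penalty at the full rate \<open>\<beta>\<close>, while \<open>F\<close> can rise at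
  most at the smaller rate \<open>gain\<close>. A nonzero residual would make it a descent
  direction.\<close>

lemma stationary_imp_feasible:
  assumes "\<And>d. 0 \<le> dir_deriv \<Theta> z d"
  shows "residual z = 0"
proof (rule zero_if_weighted_sum_nonneg)
  obtain d where d: "fst d = 0" "lin_residual z d = - residual z"
    by (rule lin_residual_surj)
  have "abs_dir r (- r) = - \<bar>r\<bar>" for r :: real by (simp add: abs_dir_def sgn_if abs_if)
  then have "0 \<le> grad F z \<bullet> d - (\<Sum>i\<in>UNIV. \<beta> (layer i) * \<bar>residual z $ i\<bar>)"
    using assms[of d] by (simp add: Theta_dir_deriv d sum_negf)
  then show "0 \<le> (\<Sum>i\<in>UNIV. gain (layer i) * \<bar>residual z $ i\<bar>) - (\<Sum>i\<in>UNIV. \<beta> (layer i) * \<bar>residual z $ i\<bar>)"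
    using F_deriv_diff[of d 0] d by (simp add: lin_residual_0)
qed

text \<open>The direction \<open>d\<close> is compared with a corrected one having the same first
  component and zero linearized residual. Stationarity makes \<open>F\<close> nondecreasing to first
  order along the latter, so a nonzero linearized residual would cost more penalty than
  \<open>F\<close> can gain along \<open>d\<close>.\<close>

lemma stationary_imp_critical_direction_feasible:
  assumes "\<And>d. 0 \<le> dir_deriv \<Theta> z d" "dir_deriv \<Theta> z d = 0"
  shows "lin_residual z d = 0"
proof (rule zero_if_weighted_sum_nonneg)
  note r = stationary_imp_feasible[OF assms(1)]
  obtain d' where d': "fst d' = fst d" "lin_residual z d' = 0"
    by (rule lin_residual_surj)
  have "0 \<le> grad F z \<bullet> d'"
    using assms(1)[of d'] by (simp add: Theta_dir_deriv d' r abs_dir_def)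
  moreover have "grad F z \<bullet> d + (\<Sum>i\<in>UNIV. \<beta> (layer i) * \<bar>lin_residual z d $ i\<bar>) = 0"
    using assms(2) by (simp add: Theta_dir_deriv r abs_dir_def)
  ultimately show "0 \<le> (\<Sum>i\<in>UNIV. gain (layer i) * \<bar>lin_residual z d $ i\<bar>) - (\<Sum>i\<in>UNIV. \<beta> (layer i) * \<bar>lin_residual z d $ i\<bar>)"
    using F_deriv_diff[OF d'(1)] d'(2) by simp
qed

lemma stationary_imp_second_order_stationary:
  assumes "\<And>d. 0 \<le> dir_deriv \<Theta> z d"
  shows "second_order_d_stationary \<Theta> z"
  unfolding second_order_d_stationary_def
proof (intro conjI allI impI)
  fix d assume d: "dir_deriv \<Theta> z d = 0"
  have r: "residual z = 0" "lin_residual z d = 0"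
    using stationary_imp_feasible stationary_imp_critical_direction_feasible assms d by auto
  then have "grad F z \<bullet> d = 0" using d by (simp add: Theta_dir_deriv abs_dir_def)
  then show "0 \<le> dir_deriv2 \<Theta> z d"
    using Theta_has_dir_deriv2[OF r] dir_deriv2I by metis
qed (use assms in auto)

end

theorem corollary3p3:
  fixes L :: nat
    and layer :: "'m::finite \<Rightarrow> nat"
    and g :: "real^'m \<Rightarrow> real"
    and \<psi> :: "nat \<Rightarrow> (real^'n::finite) \<times> (real^'m) \<Rightarrow> real^'m"
    and lam :: real
    and \<beta> K :: "nat \<Rightarrow> real"
    and K\<^sub>g :: real
    and z0 z1 :: "(real^'n) \<times> (real^'m)"
    and A :: "'m set"
    and I :: nat
    and P :: "nat \<Rightarrow> ((real^'n) \<times> (real^'m)) set"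
    and \<rho>1 \<eta>1 \<eta>2 \<delta> :: real
  defines "F \<equiv> F_fun g lam"
    and "\<Theta> \<equiv> Theta L layer g lam \<beta> \<psi>"
    and "H \<equiv> H_fun layer \<beta> \<psi> A"
    and "c \<equiv> c_fun layer \<beta> \<psi>"
  assumes layers: "layer ` UNIV = {1..L}"
    and g_nonneg: "\<And>u. 0 \<le> g u"
    and g_lipschitz: "locally_lipschitz g"
    and g_twice: "twice_dir_differentiable g"
    and g_smooth: "smooth g"
    and g_convex: "convex_on UNIV g"
    and psi_map: "\<And>l. l \<in> {1..L} \<Longrightarrow> layer_map layer l (\<psi> (l - 1))"
    and psi_lipschitz: "\<And>l. l \<in> {1..L} \<Longrightarrow> locally_lipschitz (\<psi> (l - 1))"
    and psi_twice: "\<And>l. l \<in> {1..L} \<Longrightarrow> twice_dir_differentiable (\<psi> (l - 1))"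
    and psi_affine: "\<And>i. i \<in> A \<Longrightarrow> piecewise_affine (\<lambda>z. \<psi> (layer i - 1) z $ i)"
    and psi_smooth: "\<And>i. i \<notin> A \<Longrightarrow> smooth (\<lambda>z. \<psi> (layer i - 1) z $ i)"
    and lam_pos: "0 < lam"
    and beta_pos: "\<And>l. l \<in> {1..L} \<Longrightarrow> 0 < \<beta> l"
    and z0_theta: "fst z0 = 0"
    and z0_u: "\<And>l. l \<in> {1..L} \<Longrightarrow>
          block layer l (snd z0) = \<psi> (l - 1) (0, blocks_upto layer (l - 1) (snd z0))"
    and P_polyhedron: "\<And>i. i \<in> {1..I} \<Longrightarrow> polyhedron (P i)"
    and P_nonempty: "\<And>i. i \<in> {1..I} \<Longrightarrow> P i \<noteq> {}"
    and P_distinct: "inj_on P {1..I}"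
    and P_cover: "(\<Union>i\<in>{1..I}. P i) = UNIV"
    and P_affine: "\<And>i. i \<in> {1..I} \<Longrightarrow> affine_fun_on H (P i)"
    and rho1: "0 < \<rho>1"
    and eta1: "0 < \<eta>1" "\<eta>1 < 1"
    and eta2: "1 < \<eta>2"
    and delta: "0 < \<delta>"
    and Kg_pos: "0 < K\<^sub>g"
    and K_pos: "\<And>l. l \<in> {1..L - 1} \<Longrightarrow> 0 < K l"
    and g_deriv_bound: "\<And>\<theta> u d\<^sub>u d\<^sub>u'. \<Theta> (\<theta>, u) \<le> \<Theta> z0 \<Longrightarrow>
          \<bar>dir_deriv g u d\<^sub>u - dir_deriv g u d\<^sub>u'\<bar> \<le> K\<^sub>g * norm (d\<^sub>u - d\<^sub>u')"
    and psi_deriv_bound: "\<And>\<theta> u d\<^sub>\<theta> d\<^sub>u d\<^sub>u' l. \<Theta> (\<theta>, u) \<le> \<Theta> z0 \<Longrightarrow> l \<in> {2..L} \<Longrightarrow>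
          norm (dir_deriv (\<psi> (l - 1)) (\<theta>, blocks_upto layer (l - 1) u)
                  (d\<^sub>\<theta>, blocks_upto layer (l - 1) d\<^sub>u)
              - dir_deriv (\<psi> (l - 1)) (\<theta>, blocks_upto layer (l - 1) u)
                  (d\<^sub>\<theta>, blocks_upto layer (l - 1) d\<^sub>u'))
            \<le> K (l - 1) * norm (blocks_upto layer (l - 1) d\<^sub>u - blocks_upto layer (l - 1) d\<^sub>u')"
    and beta_large: "\<And>l. l \<in> {1..L} \<Longrightarrow> \<beta> l > K\<^sub>g * (\<Prod>j=l+1..L. 1 + K (j - 1))"
    and start: "\<Theta> z1 \<le> \<Theta> z0"
  shows "(\<forall>Z \<rho> s k. srpa_terminating_run F H (- A) c I P \<delta> \<Theta> \<eta>1 \<eta>2 z1 \<rho>1 Z \<rho> s k \<longrightarrow>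
            second_order_d_stationary \<Theta> (Z k)) \<and>
         (\<forall>Z \<rho> s. srpa_infinite_run F H (- A) c I P \<delta> \<Theta> \<eta>1 \<eta>2 z1 \<rho>1 Z \<rho> s \<longrightarrow>
            (\<forall>z. accumulation_point z Z \<longrightarrow> second_order_d_stationary \<Theta> z))"
proof -
  interpret net: layered_network L layer g \<psi> lam \<beta>
    using layers g_nonneg g_twice g_smooth g_convex psi_map psi_lipschitz psi_twice lam_pos beta_pos
    by unfold_locales
  interpret alg: srpa F H "- A" c I P \<delta> \<Theta> \<eta>1 \<eta>2 z1 \<rho>1
  proof
    show "smooth F" unfolding F_def by (rule F_fun_smooth(1)[OF g_smooth])
    show "smooth (c j)" if "j \<in> - A" for j
      unfolding c_def using psi_smooth that by (intro net.c_fun_smooth) simp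
    show "continuous_on UNIV H" unfolding H_def by (rule net.H_fun_continuous)
    show "0 \<le> F z" for z unfolding F_def by (rule net.Theta_nonneg_parts)
    show "0 \<le> H z" for z unfolding H_def by (rule net.H_fun_nonneg)
    show "\<Theta> z = F z + H z + (\<Sum>j\<in>- A. \<bar>c j z\<bar>)" for z
      unfolding F_def H_def c_def \<Theta>_def by (rule Theta_decomposition[OF layers psi_map beta_pos])
    show "bounded {z. \<Theta> z \<le> \<Theta> z1}" unfolding \<Theta>_def by (rule net.level_set_bounded)
  qed (use P_cover delta eta1 eta2 rho1 in auto)
  \<comment> \<open>Both claims reduce to a point of the initial level set at which the model is
    locally minimal for some parameter.\<close>
  have main: "second_order_d_stationary \<Theta> z"
    if min: "(\<exists>r. model_local_min F H (- A) c z r) \<and> \<Theta> z \<le> \<Theta> z1" for z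
  proof -
    \<comment> \<open>The condition on the initial point places \<open>z\<close> in the level set of
      \<open>z0\<close>, where the derivative bounds are available.\<close>
    have level: "\<Theta> (fst z, snd z) \<le> \<Theta> z0" using min start by simp
    interpret pen: exact_penalty L layer g \<psi> lam \<beta> K K\<^sub>g z
      by unfold_locales (rule K_pos g_deriv_bound[OF level] Kg_pos psi_deriv_bound[OF level] beta_large; assumption)+
    have "0 \<le> dir_deriv \<Theta> z d" for d
    proof -
      have D: "has_dir_deriv \<Theta> z d (dir_deriv \<Theta> z d)"
        unfolding \<Theta>_def net.Theta_dir_deriv by (rule net.Theta_has_dir_deriv)
      from min obtain r where r: "model_local_min F H (- A) c z r" by blast
      show ?thesis
        by (rule model_local_min_dir_deriv_nonneg[OF alg.F_smooth _ alg.\<Theta>_eq r D]) (rule alg.c_smooth)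
    qed
    then show ?thesis
      unfolding \<Theta>_def by (rule pen.stationary_imp_second_order_stationary)
  qed
  show ?thesis
    using main alg.terminating_run_model_local_min alg.accumulation_point_model_local_min by blast
qed

end
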